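(* Let $m=2k\ge4$ be an even integer, let $G=\langle s,t\mid \Pi(s,t,m)=\Pi(t,s,m)\rangle$ be the Artin group of type $I_2(m)$, let $M$ be the submonoid of $G$ generated by $\{s,t\}$, and let $\Delta=\Pi(s,t,m)=(st)^k=(ts)^k$. Let $G_1$ (resp. $M_1$) be the subgroup (resp. submonoid) generated by $t$, with $\Delta_1=t$, and let $H$ (resp. $N$) be the subgroup (resp. submonoid) generated by $s$, with $\Lambda=s$. Then, with respect to the Garside structure $(G,M,\Delta)$, the pair $(H,G_1)$ is a Dehornoy structure on $G$.
   Context: $\Pi(s,t,m)$ denotes the alternating word $sts\cdots$ of length $m$. For $\alpha,\beta\in G$: $\alpha\le_R\beta$ iff $\beta\alpha^{-1}\in M$. It is known that $(G,M,\Delta)$ is a Garside structure with $\Delta$ central in $G$, and that $(G_1,M_1,\Delta_1)$ and $(H,N,\Lambda)$ are parabolic substructures of it. An element $a\in M$ is unmovable if $\Delta\not\le_R a$. Every $\alpha\in G$ is uniquely $\alpha=a\Delta^j$ with $a\in M$ unmovable and $j\in\mathbb Z$ (the $\Delta$-form of $\alpha$). Depth. For $K\in\{M_1,N\}$ and $a\in M$, $\tau_K(a)$ denotes the unique $b\in K$ with $\{c\in K\mid c\le_R a\}=\{c\in K\mid c\le_R b\}$. Every $a\in M\setminus\{1\}$ is uniquely $a=a_p\cdots a_2a_1$ with $a_p\ne1$, $a_i=\tau_{M_1}(a_p\cdots a_i)$ for $i$ odd and $a_i=\tau_N(a_p\cdots a_i)$ for $i$ even; set $\mathrm{bh}(a)=p$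 and $\mathrm{bh}(1)=1$. The depth is $\mathrm{dpt}(a)=(\mathrm{bh}(a)-1)/2$ if $\mathrm{bh}(a)$ is odd and $\mathrm{bh}(a)/2$ if $\mathrm{bh}(a)$ is even. Dehornoy structure. An element $\alpha\in G$ with $\Delta$-form $\alpha=a\Delta^{-j}$ is $(H,G_1)$-negative if $j\ge1$ and $\mathrm{dpt}(a)<\mathrm{dpt}(\Delta^j)$; $\alpha$ is $(H,G_1)$-positive if $\alpha^{-1}$ is $(H,G_1)$-negative. Let $P$ be the set of $(H,G_1)$-positive elements; $P^{-1}$ is then the set of $(H,G_1)$-negative elements. The pair $(H,G_1)$ is a Dehornoy structure if (a) $PP\subset P$, (b) $G_1PG_1\subset P$, (c) $G=P\sqcup P^{-1}\sqcup G_1$ (disjoint union). *)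

theory Defs
  imports "HOL-Algebra.Coset" "HOL-Algebra.Generated_Groups"
begin

section \<open>Groups given by a presentation\<close>

text \<open>A letter \<open>(x, True)\<close> stands for the generator \<open>x\<close> and \<open>(x, False)\<close> for its inverse.
  All elements of the type \<open>'x\<close> are generators.\<close>

type_synonym 'x signed_word = "('x \<times> bool) list"

inductive pres_eq ::
    "('x signed_word \<times> 'x signed_word) set \<Rightarrow> 'x signed_word \<Rightarrow> 'x signed_word \<Rightarrow> bool"
  for R where
    pres_refl: "pres_eq R u u"
  | pres_sym: "pres_eq R u v \<Longrightarrow> pres_eq R v u"
  | pres_trans: "pres_eq R u v \<Longrightarrow> pres_eq R v w \<Longrightarrow> pres_eq R u w"
  | pres_cong: "pres_eq R u u' \<Longrightarrow> pres_eq R v v' \<Longrightarrow> pres_eq R (u @ v) (u' @ v')"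
  | pres_cancel: "pres_eq R [(x, e), (x, \<not> e)] []"
  | pres_rel: "(u, v) \<in> R \<Longrightarrow> pres_eq R u v"

definition pres_rel_set ::
    "('x signed_word \<times> 'x signed_word) set \<Rightarrow> ('x signed_word \<times> 'x signed_word) set" where
  "pres_rel_set R = {(u, v). pres_eq R u v}"

definition pres_class ::
    "('x signed_word \<times> 'x signed_word) set \<Rightarrow> 'x signed_word \<Rightarrow> 'x signed_word set" where
  "pres_class R u = pres_rel_set R `` {u}"

definition presented_group ::
    "('x signed_word \<times> 'x signed_word) set \<Rightarrow> 'x signed_word set monoid" where
  "presented_group R =
    \<lparr>carrier = UNIV // pres_rel_set R,
     mult = (\<lambda>A B. \<Union>u\<in>A. \<Union>v\<in>B. pres_class R (u @ v)),
     one = pres_class R []\<rparr>"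

lemma equiv_pres_rel_set: "equiv UNIV (pres_rel_set R)"
proof (rule equivI)
  show "refl (pres_rel_set R)"
    by (simp add: pres_rel_set_def refl_on_def pres_refl)
  show "sym (pres_rel_set R)"
    by (simp add: pres_rel_set_def sym_def pres_sym)
  show "trans (pres_rel_set R)"
    unfolding pres_rel_set_def trans_def using pres_trans[of R] by blast
qed simp

lemma pres_class_eq_iff: "pres_class R u = pres_class R v \<longleftrightarrow> pres_eq R u v"
  using equiv_class_eq_iff[OF equiv_pres_rel_set[of R], of u v]
  by (auto simp: pres_class_def pres_rel_set_def)

lemma mem_pres_class: "v \<in> pres_class R u \<longleftrightarrow> pres_eq R u v"
  by (simp add: pres_class_def pres_rel_set_def)

lemma carrier_presented_group: "carrier (presented_group R) = range (pres_class R)"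
  by (auto simp: presented_group_def quotient_def pres_class_def)

lemma one_presented_group: "\<one>\<^bsub>presented_group R\<^esub> = pres_class R []"
  by (simp add: presented_group_def)

lemma mult_presented_group:
  "pres_class R u \<otimes>\<^bsub>presented_group R\<^esub> pres_class R v = pres_class R (u @ v)"
proof -
  have "pres_class R (u' @ v') = pres_class R (u @ v)"
    if "u' \<in> pres_class R u" "v' \<in> pres_class R v" for u' v'
    using that unfolding mem_pres_class pres_class_eq_iff
    by (intro pres_sym[OF pres_cong])
  then have "(\<Union>u'\<in>pres_class R u. \<Union>v'\<in>pres_class R v. pres_class R (u' @ v')) =
      (\<Union>u'\<in>pres_class R u. \<Union>v'\<in>pres_class R v. pres_class R (u @ v))"
    by (intro SUP_cong refl)
  moreover have "u \<in> pres_class R u" "v \<in> pres_class R v"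
    unfolding mem_pres_class by (rule pres_refl)+
  then have "pres_class R u \<noteq> {}" "pres_class R v \<noteq> {}"
    by blast+
  ultimately show ?thesis
    by (simp add: presented_group_def)
qed

lemma pres_inverse_word: "pres_eq R (rev (map (\<lambda>(x, e). (x, \<not> e)) w) @ w) []"
proof (induction w)
  case Nil
  show ?case by (simp add: pres_refl)
next
  case (Cons l w)
  obtain x e where l: "l = (x, e)" by fastforce
  let ?i = "rev (map (\<lambda>(x, e). (x, \<not> e)) w)"
  have "pres_eq R ([(x, \<not> e), (x, e)] @ w) ([] @ w)"
    using pres_cancel[of R x "\<not> e"] by (intro pres_cong pres_refl) simp
  then have "pres_eq R (?i @ ([(x, \<not> e), (x, e)] @ w)) (?i @ [] @ w)"
    by (rule pres_cong[OF pres_refl])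
  then have "pres_eq R (?i @ ([(x, \<not> e), (x, e)] @ w)) (?i @ w)"
    by simp
  then have "pres_eq R (?i @ ([(x, \<not> e), (x, e)] @ w)) []"
    using Cons.IH by (rule pres_trans)
  then show ?case
    by (simp add: l)
qed

lemma group_presented_group: "group (presented_group R)"
proof (rule groupI)
  fix x assume "x \<in> carrier (presented_group R)"
  then obtain w where "x = pres_class R w"
    by (auto simp: carrier_presented_group)
  then show "\<exists>y\<in>carrier (presented_group R). y \<otimes>\<^bsub>presented_group R\<^esub> x = \<one>\<^bsub>presented_group R\<^esub>"
    using pres_inverse_word[of R w]
    by (auto simp: carrier_presented_group mult_presented_group one_presented_group pres_class_eq_iff)
qed (auto simp: carrier_presented_group mult_presented_group one_presented_group)


section \<open>Artin groups of type $I_2(m)$\<close>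

datatype artin_gen = Gen_s | Gen_t

fun alt_word :: "'a \<Rightarrow> 'a \<Rightarrow> nat \<Rightarrow> 'a list" where
  "alt_word x y 0 = []"
| "alt_word x y (Suc n) = x # alt_word y x n"

definition artin_I2_rels :: "nat \<Rightarrow> (artin_gen signed_word \<times> artin_gen signed_word) set" where
  "artin_I2_rels m =
    {(map (\<lambda>x. (x, True)) (alt_word Gen_s Gen_t m),
      map (\<lambda>x. (x, True)) (alt_word Gen_t Gen_s m))}"

definition artin_I2 :: "nat \<Rightarrow> artin_gen signed_word set monoid" where
  "artin_I2 m = presented_group (artin_I2_rels m)"

definition artin_I2_gen :: "nat \<Rightarrow> artin_gen \<Rightarrow> artin_gen signed_word set" where
  "artin_I2_gen m x = pres_class (artin_I2_rels m) [(x, True)]"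

definition alt_prod :: "('g, 'z) monoid_scheme \<Rightarrow> 'g \<Rightarrow> 'g \<Rightarrow> nat \<Rightarrow> 'g" where
  "alt_prod G x y n = foldr (\<otimes>\<^bsub>G\<^esub>) (alt_word x y n) \<one>\<^bsub>G\<^esub>"

definition submonoid_generated :: "('g, 'z) monoid_scheme \<Rightarrow> 'g set \<Rightarrow> 'g set" where
  "submonoid_generated G X = \<Inter>{K. submonoid K G \<and> X \<subseteq> K}"


section \<open>Depth and Dehornoy structures\<close>

text \<open>Below, \<open>M\<close> is the positive monoid and \<open>D\<close> the Garside element of a Garside structure
  on the group \<open>G\<close>; \<open>M1\<close> and \<open>N\<close> are the positive monoids of two parabolic substructures.\<close>

definition le_R :: "('g, 'z) monoid_scheme \<Rightarrow> 'g set \<Rightarrow> 'g \<Rightarrow> 'g \<Rightarrow> bool" where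
  "le_R G M \<alpha> \<beta> \<longleftrightarrow> \<beta> \<otimes>\<^bsub>G\<^esub> inv\<^bsub>G\<^esub> \<alpha> \<in> M"

definition unmovable :: "('g, 'z) monoid_scheme \<Rightarrow> 'g set \<Rightarrow> 'g \<Rightarrow> 'g \<Rightarrow> bool" where
  "unmovable G M D a \<longleftrightarrow> a \<in> M \<and> \<not> le_R G M D a"

definition is_Delta_form ::
    "('g, 'z) monoid_scheme \<Rightarrow> 'g set \<Rightarrow> 'g \<Rightarrow> 'g \<Rightarrow> 'g \<Rightarrow> int \<Rightarrow> bool" where
  "is_Delta_form G M D \<alpha> a j \<longleftrightarrow> unmovable G M D a \<and> \<alpha> = a \<otimes>\<^bsub>G\<^esub> (D [^]\<^bsub>G\<^esub> j)"

definition tail :: "('g, 'z) monoid_scheme \<Rightarrow> 'g set \<Rightarrow> 'g set \<Rightarrow> 'g \<Rightarrow> 'g" where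
  "tail G M K a = (THE b. b \<in> K \<and> {c \<in> K. le_R G M c a} = {c \<in> K. le_R G M c b})"

text \<open>The product \<open>x p \<otimes> x (p - 1) \<otimes> \<dots> \<otimes> x i\<close>, with indices decreasing from left to right.\<close>

definition desc_prod :: "('g, 'z) monoid_scheme \<Rightarrow> (nat \<Rightarrow> 'g) \<Rightarrow> nat \<Rightarrow> nat \<Rightarrow> 'g" where
  "desc_prod G x p i = foldr (\<lambda>j y. x j \<otimes>\<^bsub>G\<^esub> y) (rev [i..<Suc p]) \<one>\<^bsub>G\<^esub>"

definition is_alternating_form ::
    "('g, 'z) monoid_scheme \<Rightarrow> 'g set \<Rightarrow> 'g set \<Rightarrow> 'g set \<Rightarrow> 'g \<Rightarrow> nat \<Rightarrow> (nat \<Rightarrow> 'g) \<Rightarrow> bool" where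
  "is_alternating_form G M M1 N a p x \<longleftrightarrow>
     1 \<le> p \<and> (\<forall>i\<in>{1..p}. x i \<in> M) \<and> a = desc_prod G x p 1 \<and> x p \<noteq> \<one>\<^bsub>G\<^esub> \<and>
     (\<forall>i\<in>{1..p}. x i = tail G M (if odd i then M1 else N) (desc_prod G x p i))"

definition bh :: "('g, 'z) monoid_scheme \<Rightarrow> 'g set \<Rightarrow> 'g set \<Rightarrow> 'g set \<Rightarrow> 'g \<Rightarrow> nat" where
  "bh G M M1 N a =
    (if a = \<one>\<^bsub>G\<^esub> then 1 else (THE p. \<exists>x. is_alternating_form G M M1 N a p x))"

definition dpt :: "('g, 'z) monoid_scheme \<Rightarrow> 'g set \<Rightarrow> 'g set \<Rightarrow> 'g set \<Rightarrow> 'g \<Rightarrow> nat" where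
  "dpt G M M1 N a =
    (if odd (bh G M M1 N a) then (bh G M M1 N a - 1) div 2 else bh G M M1 N a div 2)"

definition dehornoy_negative ::
    "('g, 'z) monoid_scheme \<Rightarrow> 'g set \<Rightarrow> 'g \<Rightarrow> 'g set \<Rightarrow> 'g set \<Rightarrow> 'g \<Rightarrow> bool" where
  "dehornoy_negative G M D N M1 \<alpha> \<longleftrightarrow>
     \<alpha> \<in> carrier G \<and>
     (\<exists>a. \<exists>j::int. is_Delta_form G M D \<alpha> a (- j) \<and> 1 \<le> j \<and>
        dpt G M M1 N a < dpt G M M1 N (D [^]\<^bsub>G\<^esub> j))"

definition dehornoy_positive ::
    "('g, 'z) monoid_scheme \<Rightarrow> 'g set \<Rightarrow> 'g \<Rightarrow> 'g set \<Rightarrow> 'g set \<Rightarrow> 'g \<Rightarrow> bool" where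
  "dehornoy_positive G M D N M1 \<alpha> \<longleftrightarrow>
     \<alpha> \<in> carrier G \<and> dehornoy_negative G M D N M1 (inv\<^bsub>G\<^esub> \<alpha>)"

text \<open>A Garside structure is passed as \<open>(G, M, D)\<close> and its parabolic substructures as
  \<open>(H, N, L)\<close> and \<open>(G1, M1, D1)\<close>. The notion depends on \<open>H\<close> only through \<open>N\<close>, and not on
  the Garside elements \<open>L\<close> and \<open>D1\<close>.\<close>

fun dehornoy_structure ::
    "('g, 'z) monoid_scheme \<times> 'g set \<times> 'g \<Rightarrow> 'g set \<times> 'g set \<times> 'g \<Rightarrow>
     'g set \<times> 'g set \<times> 'g \<Rightarrow> bool" where
  "dehornoy_structure (G, M, D) (H, N, L) (G1, M1, D1) \<longleftrightarrow>
    (let P = {\<alpha>. dehornoy_positive G M D N M1 \<alpha>} in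
      P <#>\<^bsub>G\<^esub> P \<subseteq> P \<and>
      G1 <#>\<^bsub>G\<^esub> P <#>\<^bsub>G\<^esub> G1 \<subseteq> P \<and>
      carrier G = P \<union> set_inv\<^bsub>G\<^esub> P \<union> G1 \<and>
      P \<inter> set_inv\<^bsub>G\<^esub> P = {} \<and> P \<inter> G1 = {} \<and> set_inv\<^bsub>G\<^esub> P \<inter> G1 = {})"

end

theory Submission
  imports Defs Complex_Main
begin

text \<open>Since \<open>\<Delta>\<close> is central, every element can be brought into the form \<open>w \<Delta>\<^sup>n\<close>, where \<open>w\<close> is a
  positive word without an alternating factor of length \<open>m\<close>; uniqueness comes from an action of
  \<open>G\<close> on such pairs \<open>(w, n)\<close>. This makes tails computable, and the depth of \<open>w\<close> turns out to be
  its number of \<open>s\<close>-syllables, while \<open>\<Delta>\<^sup>j\<close> has depth \<open>j (k - 1) + 1\<close>.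

  As \<open>G\<close> is generated by \<open>t\<close> and \<open>st\<close> with the only relation that \<open>(st)\<^sup>k\<close> commutes with \<open>t\<close>,
  it acts on the real line with \<open>st\<close> the translation by \<open>1 - 1/k\<close> and \<open>t\<close> any increasing bijection
  commuting with the translation by 1. With \<open>t\<close> fixing the integers and expanding strongly to
  their right, a ping-pong argument shows that a word \<open>w\<close> as above with \<open>q > 0\<close> syllables \<open>s\<close>
  moves 0 into \<open>[q - 1, q)\<close>, whereas \<open>\<Delta>\<close> is the translation by \<open>k - 1\<close>. Hence the negative
  elements are those that move 0 to the left, and \<open>G\<^sub>1\<close> is the stabilizer of 0. The axioms of a
  Dehornoy structure are then immediate.\<close>

section \<open>Homomorphisms out of a presented group\<close>

definition eval_word :: "('g, 'z) monoid_scheme \<Rightarrow> ('x \<Rightarrow> 'g) \<Rightarrow> 'x signed_word \<Rightarrow> 'g" where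
  "eval_word K f w = foldr (\<lambda>(x, e) a. (if e then f x else inv\<^bsub>K\<^esub> f x) \<otimes>\<^bsub>K\<^esub> a) w \<one>\<^bsub>K\<^esub>"

lemma eval_word_simps [simp]:
  "eval_word K f [] = \<one>\<^bsub>K\<^esub>"
  "eval_word K f ((x, e) # w) = (if e then f x else inv\<^bsub>K\<^esub> f x) \<otimes>\<^bsub>K\<^esub> eval_word K f w"
  by (simp_all add: eval_word_def)

context group
begin

lemma eval_word_closed:
  assumes "range f \<subseteq> carrier G"
  shows "eval_word G f w \<in> carrier G"
  using assms by (induction w) (auto simp: image_subset_iff)

lemma eval_word_append:
  assumes "range f \<subseteq> carrier G"
  shows "eval_word G f (u @ v) = eval_word G f u \<otimes> eval_word G f v"
  using assms by (induction u) (auto simp: image_subset_iff eval_word_closed m_assoc)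

lemma eval_word_pres_eq:
  assumes f: "range f \<subseteq> carrier G"
    and R: "\<And>u v. (u, v) \<in> R \<Longrightarrow> eval_word G f u = eval_word G f v"
    and "pres_eq R u v"
  shows "eval_word G f u = eval_word G f v"
  using assms(3)
proof (induction rule: pres_eq.induct)
  case (pres_cancel x e)
  have "f x \<in> carrier G" using f by auto
  then show ?case by (cases e) auto
qed (auto simp: eval_word_append[OF f] R)

text \<open>The value on a class is computed from a chosen representative;
  \<open>eval_word_pres_eq\<close> makes the choice irrelevant.\<close>

lemma presented_group_universal:
  assumes f: "range f \<subseteq> carrier G"
    and R: "\<And>u v. (u, v) \<in> R \<Longrightarrow> eval_word G f u = eval_word G f v"
  obtains h where "h \<in> hom (presented_group R) G" "\<And>x. h (pres_class R [(x, True)]) = f x"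
proof
  define h where "h A = eval_word G f (SOME w. w \<in> A)" for A
  have h: "h (pres_class R w) = eval_word G f w" for w
  proof -
    have "(SOME v. v \<in> pres_class R w) \<in> pres_class R w"
      by (rule someI[of _ w]) (simp add: mem_pres_class pres_refl)
    then have "pres_eq R w (SOME v. v \<in> pres_class R w)"
      by (simp add: mem_pres_class)
    from eval_word_pres_eq[OF f R this] show ?thesis
      by (simp add: h_def)
  qed
  show "h \<in> hom (presented_group R) G"
    by (rule homI)
      (auto simp: carrier_presented_group mult_presented_group h eval_word_append[OF f]
        eval_word_closed[OF f])
  show "h (pres_class R [(x, True)]) = f x" for x
    using f by (simp add: h image_subset_iff)
qed

end

lemma pres_class_inverse_letter:
  "pres_class R [(x, False)] = inv\<^bsub>presented_group R\<^esub> pres_class R [(x, True)]"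
proof (rule sym, rule group.inv_equality[OF group_presented_group])
  show "pres_class R [(x, False)] \<otimes>\<^bsub>presented_group R\<^esub> pres_class R [(x, True)]
      = \<one>\<^bsub>presented_group R\<^esub>"
    using pres_cancel[of R x False]
    by (simp add: mult_presented_group one_presented_group pres_class_eq_iff)
qed (auto simp: carrier_presented_group)

lemma presented_group_induct [consumes 1, case_names one gen inv]:
  fixes R
  defines "K \<equiv> presented_group R"
  assumes "\<alpha> \<in> carrier K"
    and one: "P \<one>\<^bsub>K\<^esub>"
    and gen: "\<And>x \<beta>. \<beta> \<in> carrier K \<Longrightarrow> P \<beta> \<Longrightarrow> P (pres_class R [(x, True)] \<otimes>\<^bsub>K\<^esub> \<beta>)"
    and inv: "\<And>x \<beta>. \<beta> \<in> carrier K \<Longrightarrow> P \<beta> \<Longrightarrow> P (inv\<^bsub>K\<^esub> pres_class R [(x, True)] \<otimes>\<^bsub>K\<^esub> \<beta>)"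
  shows "P \<alpha>"
proof -
  have "P (pres_class R w)" for w
  proof (induction w)
    case Nil
    then show ?case using one by (simp add: K_def one_presented_group)
  next
    case (Cons l w)
    obtain x e where l: "l = (x, e)" by fastforce
    have c: "pres_class R w \<in> carrier K"
      by (simp add: K_def carrier_presented_group)
    have split: "pres_class R (l # w) = pres_class R [l] \<otimes>\<^bsub>K\<^esub> pres_class R w"
      by (simp add: K_def mult_presented_group)
    show ?case
      using gen[OF c Cons.IH, of x] inv[OF c Cons.IH, of x]
      unfolding split by (cases e) (simp_all add: l pres_class_inverse_letter K_def)
  qed
  then show ?thesis
    using assms(2) by (auto simp: K_def carrier_presented_group)
qed

section \<open>Permutation groups as targets of actions\<close>

definition perm_group :: "('a \<Rightarrow> 'a) monoid" where
  "perm_group = \<lparr>carrier = {f. bij f}, mult = (\<circ>), one = id\<rparr>"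

lemma perm_group_simps [simp]:
  "carrier perm_group = {f. bij f}"
  "f \<otimes>\<^bsub>perm_group\<^esub> g = f \<circ> g"
  "\<one>\<^bsub>perm_group\<^esub> = id"
  by (simp_all add: perm_group_def)

lemma group_perm_group: "group perm_group"
proof (rule groupI)
  fix f :: "'a \<Rightarrow> 'a" assume "f \<in> carrier perm_group"
  then show "\<exists>g\<in>carrier perm_group. g \<otimes>\<^bsub>perm_group\<^esub> f = \<one>\<^bsub>perm_group\<^esub>"
    by (intro bexI[of _ "inv_into UNIV f"]) (auto simp: bij_imp_bij_inv bij_is_inj)
qed (auto simp: bij_comp)

lemma eval_word_perm_group:
  "eval_word perm_group f (map (\<lambda>x. (x, True)) w) p = foldr f w p"
  by (induction w) auto


section \<open>Alternating runs and reduced words\<close>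

fun flip :: "artin_gen \<Rightarrow> artin_gen" where
  "flip Gen_s = Gen_t"
| "flip Gen_t = Gen_s"

lemma flip_flip [simp]: "flip (flip g) = g"
  by (cases g) auto

lemma flip_neq [simp]: "flip g \<noteq> g" "g \<noteq> flip g"
  by (cases g; simp)+

lemma neq_iff_flip: "g \<noteq> h \<longleftrightarrow> g = flip h"
  by (cases g; cases h) auto

lemma length_alt_word [simp]: "length (alt_word x y n) = n"
  by (induction n arbitrary: x y) auto

lemma map_alt_word: "map f (alt_word x y n) = alt_word (f x) (f y) n"
  by (induction n arbitrary: x y) auto

lemma alt_word_add:
  "alt_word x y (i + j) = alt_word x y i @ (if even i then alt_word x y j else alt_word y x j)"
  by (induction i arbitrary: x y) auto

lemma alt_word_snoc: "alt_word x y (Suc i) = alt_word x y i @ [if even i then x else y]"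
  using alt_word_add[of x y i 1] by simp

lemma rev_alt_word:
  "rev (alt_word x y n) = (if even n then alt_word y x n else alt_word x y n)"
proof (induction n)
  case (Suc n)
  have "rev (alt_word x y (Suc n)) = (if even n then x else y) # rev (alt_word x y n)"
    by (simp add: alt_word_snoc del: alt_word.simps(2))
  then show ?case
    using Suc by simp
qed simp

text \<open>Length of the longest prefix in which adjacent letters differ.\<close>

fun run :: "'a list \<Rightarrow> nat" where
  "run [] = 0"
| "run (g # w) = (if w \<noteq> [] \<and> hd w \<noteq> g then Suc (run w) else 1)"

text \<open>Every suffix starts with a run shorter than \<open>m\<close>, so no factor of length
  \<open>m\<close> alternates.\<close>

fun reduced :: "nat \<Rightarrow> 'a list \<Rightarrow> bool" where
  "reduced m [] = True"
| "reduced m (g # w) \<longleftrightarrow> reduced m w \<and> run (g # w) < m"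

declare run.simps(2) [simp del]

lemma run_Cons: "run (g # w) = (if w \<noteq> [] \<and> hd w \<noteq> g then Suc (run w) else 1)"
  by (rule run.simps(2))

lemma reduced_run: "reduced m w \<Longrightarrow> w \<noteq> [] \<Longrightarrow> run w < m"
  by (cases w) auto

lemma reduced_run': "reduced m w \<Longrightarrow> 0 < m \<Longrightarrow> run w < m"
  by (cases w) auto

lemma run_append:
  "u \<noteq> [] \<Longrightarrow> v = [] \<or> hd v = last u \<Longrightarrow> run (u @ v) = run u"
proof (induction u)
  case (Cons g u)
  then show ?case
    by (cases "u = []") (auto simp: run_Cons)
qed simp

lemma reduced_append:
  "reduced m u \<Longrightarrow> reduced m v \<Longrightarrow> u = [] \<or> v = [] \<or> hd v = last u \<Longrightarrow> reduced m (u @ v)"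
proof (induction u)
  case (Cons g u)
  have "run ((g # u) @ v) = run (g # u)"
    using Cons.prems by (intro run_append) auto
  then show ?case
    using Cons by auto
qed simp

lemma reduced_appendD: "reduced m (u @ v) \<Longrightarrow> reduced m v"
  by (induction u) auto

lemma reduced_replicate: "1 < m \<Longrightarrow> reduced m (replicate n g)"
  by (induction n) (auto simp: run_Cons)

lemma reduced_appendI1: "reduced m (u @ v) \<Longrightarrow> reduced m u"
proof (induction u)
  case (Cons g u)
  have "run (g # u) \<le> run ((g # u) @ v)" for g :: 'a and u
    by (induction u arbitrary: g) (auto simp: run_Cons)
  then show ?case using Cons by (auto intro: le_less_trans)
qed simp

text \<open>The block is reversed because words grow at the front: its letter next to
  \<open>u\<close> is \<open>x\<close>, and the repetition of \<open>x\<close> there keeps the run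
  from extending into \<open>u\<close>.\<close>

lemma run_rev_alt:
  assumes "x \<noteq> y" "u = [] \<or> hd u = x" "0 < i"
  shows "run (rev (alt_word x y i) @ u) = i"
  using assms(3)
proof (induction i)
  case (Suc i)
  show ?case
  proof (cases i)
    case 0
    then show ?thesis using assms(2) by (auto simp: run_Cons)
  next
    case (Suc j)
    then show ?thesis
      using Suc.IH assms(1) by (auto simp: alt_word_snoc run_Cons simp del: alt_word.simps(2))
  qed
qed simp

lemma run_alt_word: "x \<noteq> y \<Longrightarrow> run (alt_word x y i) = i"
  using run_rev_alt[of x y "[]" i] run_rev_alt[of y x "[]" i]
  by (cases "i = 0") (auto simp: rev_alt_word split: if_splits)

lemma reduced_alt_word: "x \<noteq> y \<Longrightarrow> i < m \<Longrightarrow> reduced m (alt_word x y i)"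
proof (induction i arbitrary: x y)
  case (Suc i)
  then show ?case
    using run_alt_word[of x y "Suc i"] Suc.IH[of y x] by simp
qed simp

lemma reduced_rev_alt:
  assumes "x \<noteq> y" "u = [] \<or> hd u = x" "reduced m u" "i < m"
  shows "reduced m (rev (alt_word x y i) @ u)"
  using assms(4)
proof (induction i)
  case (Suc i)
  then show ?case
    using assms(3) run_rev_alt[OF assms(1,2), of "Suc i"]
    by (simp add: alt_word_snoc del: alt_word.simps(2))
qed (use assms in simp)

text \<open>Here \<open>a\<close> is the last letter of the initial run; indexing from that end lets
  the induction extend the block at its front while \<open>a\<close> and \<open>u\<close> stay
  fixed.\<close>

lemma run_decomp:
  fixes w :: "artin_gen list"
  obtains a u where "w = rev (alt_word a (flip a) (run w)) @ u" "u = [] \<or> hd u = a"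
    "w \<noteq> [] \<Longrightarrow> hd w = (if odd (run w) then a else flip a)"
proof -
  have "\<exists>a u. w = rev (alt_word a (flip a) (run w)) @ u \<and> (u = [] \<or> hd u = a) \<and>
    (w \<noteq> [] \<longrightarrow> hd w = (if odd (run w) then a else flip a))"
  proof (induction w)
    case (Cons g w)
    show ?case
    proof (cases "w \<noteq> [] \<and> hd w \<noteq> g")
      case True
      define L where "L = run w"
      obtain a u where
        a: "w = rev (alt_word a (flip a) L) @ u" "u = [] \<or> hd u = a"
        "hd w = (if odd L then a else flip a)"
        using Cons.IH True unfolding L_def by blast
      have g: "g = (if even L then a else flip a)"
        using a(3) True neq_iff_flip[of g "hd w"] by (auto split: if_splits)
      have r: "run (g # w) = Suc L"
        using True by (simp add: run_Cons L_def)
      have e: "g # w = rev (alt_word a (flip a) (Suc L)) @ u"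
        unfolding alt_word_snoc by (subst a(1)) (simp add: g)
      show ?thesis
        unfolding r by (intro exI[of _ a] exI[of _ u] conjI impI e a(2)) (simp add: g)
    next
      case False
      then have "run (g # w) = 1" by (auto simp: run_Cons)
      then show ?thesis
        using False by (intro exI[of _ g] exI[of _ w]) auto
    qed
  qed simp
  then show thesis using that by blast
qed


section \<open>The action on reduced words\<close>

text \<open>Left multiplication by \<open>g\<close> on pairs \<open>(w, n)\<close> standing for
  \<open>w \<Delta>^n\<close>: a prefix of \<open>g # w\<close> spelling \<Delta> moves into the
  exponent. Pairs with non-reduced \<open>w\<close> are fixed, so that a permutation of the whole
  type results.\<close>

definition step :: "nat \<Rightarrow> artin_gen \<Rightarrow> artin_gen list \<times> int \<Rightarrow> artin_gen list \<times> int" where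
  "step m g = (\<lambda>(w, n).
    if \<not> reduced m w then (w, n)
    else if run (g # w) = m then (drop (m - 1) w, n + 1)
    else (g # w, n))"

text \<open>Left multiplication by the inverse of \<open>g\<close>: unless it cancels the first
  letter, it is written as an alternating word of length \<open>m - 1\<close> times the inverse of
  \<Delta>.\<close>

definition step_back :: "nat \<Rightarrow> artin_gen \<Rightarrow> artin_gen list \<times> int \<Rightarrow> artin_gen list \<times> int" where
  "step_back m g = (\<lambda>(w, n).
    if \<not> reduced m w then (w, n)
    else if w \<noteq> [] \<and> hd w = g then (tl w, n)
    else (alt_word (flip g) g (m - 1) @ w, n - 1))"

text \<open>As \<open>m\<close> is even, the run ends in \<open>flip g\<close>, so \<open>u\<close>
  does not start with \<open>g\<close>; hence \<open>step_back\<close> puts the run back instead of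
  cancelling a letter.\<close>

lemma run_eq_m_decomp:
  assumes "even m" "2 \<le> m" "run (g # w) = m"
  obtains u where "w = alt_word (flip g) g (m - 1) @ u" "u = [] \<or> hd u = flip g"
proof -
  obtain a u where a: "g # w = rev (alt_word a (flip a) m) @ u" "u = [] \<or> hd u = a"
    "g = (if odd m then a else flip a)"
    using run_decomp[of "g # w"] assms(3) by (metis list.sel(1) list.distinct(1))
  then have ag: "a = flip g" using assms(1) by simp
  obtain j where j: "m = Suc j" using assms(2) by (cases m) auto
  have "rev (alt_word a (flip a) m) = alt_word g (flip g) m"
    using ag assms(1) by (simp add: rev_alt_word)
  then have "w = alt_word (flip g) g (m - 1) @ u"
    using a(1) j by simp
  then show thesis using that a(2) ag by blast
qed

lemma step_back_step:
  assumes "even m" "2 \<le> m"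
  shows "step_back m g (step m g p) = p"
proof -
  obtain w n where p: "p = (w, n)" by fastforce
  consider "\<not> reduced m w" | "reduced m w" "run (g # w) = m" | "reduced m w" "run (g # w) \<noteq> m"
    by blast
  then show ?thesis
  proof cases
    case 2
    obtain u where u: "w = alt_word (flip g) g (m - 1) @ u" "u = [] \<or> hd u = flip g"
      using run_eq_m_decomp[OF assms 2(2)] .
    have "reduced m u" using 2(1) u(1) reduced_appendD by blast
    then show ?thesis using 2 u by (auto simp: p step_def step_back_def)
  next
    case 3
    then have "run (g # w) < m"
      using reduced_run'[of m w] assms by (auto simp: run_Cons split: if_splits)
    then show ?thesis using 3 by (simp add: p step_def step_back_def)
  qed (simp add: p step_def step_back_def)
qed

lemma step_step_back:
  assumes "even m" "2 \<le> m"
  shows "step m g (step_back m g p) = p"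
proof -
  obtain w n where p: "p = (w, n)" by fastforce
  consider "\<not> reduced m w" | "reduced m w" "w \<noteq> []" "hd w = g" |
      "reduced m w" "w = [] \<or> hd w = flip g"
    using neq_iff_flip by blast
  then show ?thesis
  proof cases
    case 2
    then obtain v where "w = g # v" by (cases w) auto
    then show ?thesis using 2 by (auto simp: p step_def step_back_def)
  next
    case 3
    obtain j where j: "m = Suc j" using assms(2) by (cases m) auto
    then have odd: "odd j" using assms(1) by simp
    have A: "alt_word (flip g) g (m - 1) @ w = rev (alt_word (flip g) g j) @ w"
      using j odd by (simp add: rev_alt_word)
    have r1: "reduced m (alt_word (flip g) g (m - 1) @ w)"
      unfolding A using 3 j by (intro reduced_rev_alt) auto
    have "g # alt_word (flip g) g (m - 1) @ w = rev (alt_word (flip g) g m) @ w"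
      unfolding A using j odd by (simp add: alt_word_snoc del: alt_word.simps(2))
    moreover have "run (rev (alt_word (flip g) g m) @ w) = m"
      using 3 assms(2) by (intro run_rev_alt) auto
    ultimately have r2: "run (g # alt_word (flip g) g (m - 1) @ w) = m"
      by metis
    show ?thesis using 3 r1 r2 by (auto simp: p step_def step_back_def)
  qed (simp add: p step_def step_back_def)
qed

lemma bij_step:
  assumes "even m" "2 \<le> m"
  shows "bij (step m g)"
  by (rule o_bij[of "step_back m g"])
    (auto simp: step_back_step[OF assms] step_step_back[OF assms])

lemma step_reduced:
  assumes "0 < m" "reduced m w" "step m g (w, n) = (w', n')"
  shows "reduced m w'"
proof -
  have "run (g # w) \<le> m"
    using reduced_run'[OF assms(2,1)] assms(1) by (auto simp: run_Cons)
  moreover have "reduced m (drop i w)" for i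
    using assms(2) reduced_appendD[of m "take i w" "drop i w"] by simp
  ultimately show ?thesis
    using assms by (auto simp: step_def split: if_splits)
qed

text \<open>Fewer than \<open>m\<close> letters never complete a run of length \<open>m\<close>, so
  each is just pushed on. With \<open>fold\<close> the first letter acts first, hence the
  reversal.\<close>

lemma fold_step_alt:
  assumes "reduced m u" "u = [] \<or> hd u = c" "i < m"
  shows "fold (step m) (alt_word c (flip c) i) (u, n) = (rev (alt_word c (flip c) i) @ u, n)"
  using assms(3)
proof (induction i)
  case (Suc i)
  have "reduced m (rev (alt_word c (flip c) i) @ u)"
    using assms Suc.prems by (intro reduced_rev_alt) auto
  moreover have "run (rev (alt_word c (flip c) (Suc i)) @ u) = Suc i"
    using assms(2) by (intro run_rev_alt) auto
  ultimately show ?case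
    using Suc by (simp add: step_def alt_word_snoc del: alt_word.simps(2))
qed simp

text \<open>Write \<open>w\<close> as its initial run followed by \<open>u\<close>. Letting \<open>L + m\<close> alternating letters act on
  \<open>u\<close>, the first \<open>L\<close> of them produce \<open>w\<close>, while the first \<open>m\<close> of them produce \<open>u\<close> again with
  the exponent raised by one; compare the two ways of continuing.\<close>

lemma fold_step_Delta:
  assumes "even m" "2 \<le> m" "reduced m w"
  shows "fold (step m) (alt_word c (flip c) m) (w, n) = (w, n + 1)"
proof -
  \<comment> \<open>If pushing \<open>c\<close> on \<open>w\<close> does not prolong the initial
    run, take \<open>L = 0\<close> and \<open>u = w\<close>; otherwise \<open>u\<close> is what
    follows that run.\<close>
  obtain a u L where w: "w = rev (alt_word a (flip a) L) @ u" and u: "u = [] \<or> hd u = a"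
    and L: "L < m" and c: "c = (if even L then a else flip a)"
  proof (cases "w = [] \<or> hd w = c")
    case True
    then show ?thesis using that[of c 0 w] assms by auto
  next
    case False
    then have "w \<noteq> []" "c = flip (hd w)" using neq_iff_flip by auto
    then show ?thesis
      using run_decomp[of w] that reduced_run[OF assms(3)] by (metis flip_flip)
  qed
  have ru: "reduced m u" using assms(3) w reduced_appendD by blast
  let ?f = "fold (step m)"
  have "?f (alt_word a (flip a) (L + m)) (u, n) = ?f (alt_word c (flip c) m) (w, n)"
    unfolding alt_word_add using fold_step_alt[OF ru u L] c w by auto
  moreover have "?f (alt_word a (flip a) (L + m)) (u, n) = (w, n + 1)"
  proof -
    obtain j where j: "m = Suc j" using assms(2) by (cases m) auto
    have odd: "odd j" using assms(1) j by simp
    have "?f (alt_word a (flip a) m) (u, n) = step m (flip a) (rev (alt_word a (flip a) j) @ u, n)"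
      using j odd fold_step_alt[OF ru u, of j] by (simp add: alt_word_snoc del: alt_word.simps(2))
    also have "\<dots> = (u, n + 1)"
    proof -
      have "flip a # rev (alt_word a (flip a) j) @ u = rev (alt_word a (flip a) m) @ u"
        using j odd by (simp add: alt_word_snoc del: alt_word.simps(2))
      then have "run (flip a # rev (alt_word a (flip a) j) @ u) = m"
        using run_rev_alt[of a "flip a" u m] u assms(2) by (metis flip_neq(2) less_le_trans zero_less_numeral)
      moreover have "reduced m (rev (alt_word a (flip a) j) @ u)"
        using j ru u by (intro reduced_rev_alt) auto
      ultimately show ?thesis using j by (simp add: step_def)
    qed
    finally have "?f (alt_word a (flip a) (m + L)) (u, n) = ?f (alt_word a (flip a) L) (u, n + 1)"
      unfolding alt_word_add using assms(1) by simp
    then show ?thesis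
      using fold_step_alt[OF ru u L] w by (simp add: add.commute)
  qed
  ultimately show ?thesis by simp
qed

lemma foldr_step_Delta:
  assumes "even m" "2 \<le> m" "reduced m w"
  shows "foldr (step m) (alt_word c (flip c) m) (w, n) = (w, n + 1)"
  using fold_step_Delta[OF assms, of "flip c" n] assms(1)
  by (simp add: foldr_conv_fold rev_alt_word)

lemma foldr_step_not_reduced: "\<not> reduced m w \<Longrightarrow> foldr (step m) v (w, n) = (w, n)"
  by (induction v) (simp_all add: step_def)

lemma foldr_step_reduced: "reduced m w \<Longrightarrow> foldr (step m) w ([], n) = (w, n)"
  by (induction w) (auto simp: step_def)


section \<open>Normal forms in the Artin group\<close>

locale artin_even = group G for G :: "artin_gen signed_word set monoid" (structure) +
  fixes k :: nat
  assumes k: "2 \<le> k" and G_def: "G = artin_I2 (2 * k)"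
begin

definition gen :: "artin_gen \<Rightarrow> artin_gen signed_word set" where
  "gen = artin_I2_gen (2 * k)"

definition wd :: "artin_gen list \<Rightarrow> artin_gen signed_word set" where
  "wd w = foldr (\<lambda>g a. gen g \<otimes> a) w \<one>"

definition Dl :: "artin_gen signed_word set" where
  "Dl = wd (alt_word Gen_s Gen_t (2 * k))"

definition M :: "artin_gen signed_word set set" where
  "M = submonoid_generated G {gen Gen_s, gen Gen_t}"

definition powers :: "artin_gen \<Rightarrow> artin_gen signed_word set set" where
  "powers g = submonoid_generated G {gen g}"

lemma G_eq: "G = presented_group (artin_I2_rels (2 * k))"
  by (simp add: G_def artin_I2_def)

lemma gen_eq: "gen g = pres_class (artin_I2_rels (2 * k)) [(g, True)]"
  by (simp add: gen_def artin_I2_gen_def)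

lemma gen_closed [simp]: "gen g \<in> carrier G"
  by (simp add: G_eq gen_eq carrier_presented_group)

lemma group_induct [consumes 1, case_names one gen inv]:
  assumes "\<alpha> \<in> carrier G" "P \<one>"
    "\<And>g \<beta>. \<beta> \<in> carrier G \<Longrightarrow> P \<beta> \<Longrightarrow> P (gen g \<otimes> \<beta>)"
    "\<And>g \<beta>. \<beta> \<in> carrier G \<Longrightarrow> P \<beta> \<Longrightarrow> P (inv gen g \<otimes> \<beta>)"
  shows "P \<alpha>"
  using assms unfolding gen_eq unfolding G_eq by (rule presented_group_induct)

lemma wd_simps [simp]: "wd [] = \<one>" "wd (g # w) = gen g \<otimes> wd w"
  by (simp_all add: wd_def)

lemma wd_closed [simp]: "wd w \<in> carrier G"
  by (induction w) auto

lemma wd_append: "wd (u @ v) = wd u \<otimes> wd v"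
  by (induction u) (auto simp: m_assoc)

lemma wd_eq_pres_class: "wd w = pres_class (artin_I2_rels (2 * k)) (map (\<lambda>x. (x, True)) w)"
proof (induction w)
  case Nil
  show ?case unfolding wd_simps unfolding G_eq by (simp add: one_presented_group)
next
  case (Cons g w)
  show ?case
    unfolding wd_simps Cons.IH gen_eq unfolding G_eq by (simp add: mult_presented_group)
qed

lemma wd_alt: "wd (alt_word g (flip g) (2 * k)) = Dl"
proof -
  have "wd (alt_word Gen_s Gen_t (2 * k)) = wd (alt_word Gen_t Gen_s (2 * k))"
    unfolding wd_eq_pres_class pres_class_eq_iff
    by (rule pres_rel) (simp add: artin_I2_rels_def)
  then show ?thesis by (cases g) (simp_all add: Dl_def)
qed

lemma wd_replicate: "wd (replicate n g) = gen g [^] n"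
  by (induction n) (simp_all flip: nat_pow_Suc2)

lemma Dl_closed [simp]: "Dl \<in> carrier G"
  by (simp add: Dl_def)

text \<open>Both sides spell the alternating word of length \<open>2 * k + 1\<close> starting with
  \<open>g\<close>; it also ends with \<open>g\<close>, and removing either end leaves a word for
  \<Delta>.\<close>

lemma gen_Dl: "gen g \<otimes> Dl = Dl \<otimes> gen g"
proof -
  have "gen g \<otimes> Dl = wd (alt_word g (flip g) (Suc (2 * k)))"
    using wd_alt[of "flip g"] by simp
  also have "\<dots> = Dl \<otimes> gen g"
    unfolding alt_word_snoc by (simp add: wd_append wd_alt)
  finally show ?thesis .
qed

lemma Dl_central: "\<alpha> \<in> carrier G \<Longrightarrow> Dl \<otimes> \<alpha> = \<alpha> \<otimes> Dl"
proof (induction \<alpha> rule: group_induct)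
  case (gen g \<beta>)
  have "Dl \<otimes> (gen g \<otimes> \<beta>) = gen g \<otimes> (Dl \<otimes> \<beta>)"
    using gen(1) gen_Dl[of g] by (simp flip: m_assoc)
  then show ?case using gen by (simp add: m_assoc)
next
  case (inv g \<beta>)
  have "Dl \<otimes> inv gen g = inv gen g \<otimes> Dl"
    using gen_Dl[of g] by (metis Dl_closed gen_closed inv_closed inv_solve_left inv_solve_right m_assoc m_closed)
  then have "Dl \<otimes> (inv gen g \<otimes> \<beta>) = inv gen g \<otimes> (Dl \<otimes> \<beta>)"
    using inv(1) by (simp flip: m_assoc)
  then show ?case using inv by (simp add: m_assoc)
qed simp

lemma Dl_nat_pow_central: "\<alpha> \<in> carrier G \<Longrightarrow> Dl [^] (n :: nat) \<otimes> \<alpha> = \<alpha> \<otimes> Dl [^] n"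
  by (rule group_commutes_pow) (simp_all add: Dl_central)

lemma Dl_pow_central:
  assumes "\<alpha> \<in> carrier G"
  shows "Dl [^] (n :: int) \<otimes> \<alpha> = \<alpha> \<otimes> Dl [^] n"
proof (cases "n \<ge> 0")
  case True
  then show ?thesis using Dl_nat_pow_central[OF assms] by (metis int_pow_int nonneg_int_cases)
next
  case False
  then obtain l where n: "n = - int l" by (metis int_cases2 of_nat_0_le_iff)
  have "Dl [^] l \<otimes> \<alpha> = \<alpha> \<otimes> Dl [^] l" by (rule Dl_nat_pow_central[OF assms])
  then have "inv (Dl [^] l) \<otimes> \<alpha> = \<alpha> \<otimes> inv (Dl [^] l)"
    using assms by (metis Dl_closed inv_closed inv_solve_left inv_solve_right m_assoc m_closed nat_pow_closed)
  then show ?thesis by (simp add: n int_pow_neg_int)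
qed

text \<open>A completed run spells \<Delta>, which is central and so moves into the
  exponent.\<close>

lemma gen_step:
  assumes "reduced (2 * k) w" "step (2 * k) g (w, n) = (w', n')"
  shows "gen g \<otimes> (wd w \<otimes> Dl [^] n) = wd w' \<otimes> Dl [^] n'"
proof (cases "run (g # w) = 2 * k")
  case True
  obtain u where u: "w = alt_word (flip g) g (2 * k - 1) @ u"
    using run_eq_m_decomp[OF _ _ True] k by auto
  obtain j where j: "2 * k = Suc j" using k by (cases "2 * k") auto
  have "gen g \<otimes> wd w = wd (alt_word g (flip g) (2 * k)) \<otimes> wd u"
    using j by (simp add: u wd_append m_assoc)
  also have "\<dots> = wd u \<otimes> Dl"
    by (simp add: wd_alt Dl_central)
  finally have "gen g \<otimes> (wd w \<otimes> Dl [^] n) = wd u \<otimes> (Dl \<otimes> Dl [^] n)"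
    by (simp flip: m_assoc)
  also have "Dl \<otimes> Dl [^] n = Dl [^] (n + 1)"
    using int_pow_mult[of Dl 1 n] by (simp add: add.commute)
  finally show ?thesis
    using assms True u by (auto simp: step_def)
qed (use assms in \<open>auto simp: step_def m_assoc\<close>)

section \<open>Existence and uniqueness of normal forms\<close>

lemma nf_exists:
  assumes "\<alpha> \<in> carrier G"
  obtains w n where "reduced (2 * k) w" "\<alpha> = wd w \<otimes> Dl [^] (n :: int)"
proof -
  have "\<exists>w n. reduced (2 * k) w \<and> \<alpha> = wd w \<otimes> Dl [^] (n :: int)"
    using assms
  proof (induction \<alpha> rule: group_induct)
    case one
    show ?case by (rule exI[of _ "[]"], rule exI[of _ 0]) simp
  next
    case (gen g \<beta>)
    then obtain w n where w: "reduced (2 * k) w" "\<beta> = wd w \<otimes> Dl [^] (n :: int)" by auto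
    obtain w' n' where s: "step (2 * k) g (w, n) = (w', n')" by fastforce
    have "reduced (2 * k) w'" using step_reduced[OF _ w(1) s] k by simp
    then show ?case using gen_step[OF w(1) s] w(2) by auto
  next
    case (inv g \<beta>)
    then obtain w n where w: "reduced (2 * k) w" "\<beta> = wd w \<otimes> Dl [^] (n :: int)" by auto
    \<comment> \<open>Taking the preimage under \<open>step\<close> reduces an inverse letter to
      \<open>gen_step\<close>.\<close>
    obtain w' n' where "step_back (2 * k) g (w, n) = (w', n')" by fastforce
    then have s: "step (2 * k) g (w', n') = (w, n)"
      using step_step_back[of "2 * k" g "(w, n)"] k by simp
    have r: "reduced (2 * k) w'"
      using s w(1) by (auto simp: step_def split: if_splits)
    have "inv gen g \<otimes> \<beta> = wd w' \<otimes> Dl [^] n'"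
      using gen_step[OF r s] w(2)
      by (metis Dl_closed gen_closed int_pow_closed inv_solve_left m_closed wd_closed)
    then show ?case using r by auto
  qed
  then show thesis using that by blast
qed

lemma nf_exists_positive:
  obtains w n where "reduced (2 * k) w" "wd v = wd w \<otimes> Dl [^] (n :: int)" "0 \<le> n"
proof -
  have "\<exists>w n. reduced (2 * k) w \<and> wd v = wd w \<otimes> Dl [^] (n :: int) \<and> 0 \<le> n"
  proof (induction v)
    case Nil
    show ?case by (rule exI[of _ "[]"], rule exI[of _ 0]) simp
  next
    case (Cons g v)
    then obtain w n where w: "reduced (2 * k) w" "wd v = wd w \<otimes> Dl [^] (n :: int)" "0 \<le> n" by auto
    obtain w' n' where s: "step (2 * k) g (w, n) = (w', n')" by fastforce
    have "reduced (2 * k) w'" using step_reduced[OF _ w(1) s] k by simp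
    moreover have "0 \<le> n'" using s w(3) by (auto simp: step_def split: if_splits)
    ultimately show ?case using gen_step[OF w(1) s] w(2) by auto
  qed
  then show thesis using that by blast
qed

text \<open>Serves twice: for the action on reduced words and for the action on the real
  line.\<close>

lemma perm_action:
  fixes f :: "artin_gen \<Rightarrow> 'a \<Rightarrow> 'a"
  assumes bij: "\<And>g. bij (f g)"
    and rel: "\<And>p. foldr f (alt_word Gen_s Gen_t (2 * k)) p = foldr f (alt_word Gen_t Gen_s (2 * k)) p"
  obtains h where "group_hom G perm_group h" "\<And>w. h (wd w) = foldr f w"
proof -
  interpret P: group "perm_group :: ('a \<Rightarrow> 'a) monoid" by (rule group_perm_group)
  have f: "range f \<subseteq> carrier perm_group" using bij by auto
  have "eval_word perm_group f u = eval_word perm_group f v"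
    if "(u, v) \<in> artin_I2_rels (2 * k)" for u v
    using that rel by (auto simp: artin_I2_rels_def eval_word_perm_group)
  then obtain h where h: "h \<in> hom G perm_group" "\<And>g. h (gen g) = f g"
    using P.presented_group_universal[OF f, of "artin_I2_rels (2 * k)"]
    unfolding G_eq gen_eq by blast
  interpret hom: group_hom G perm_group h
    by unfold_locales (rule h(1))
  have "h (wd w) = foldr f w" for w
    by (induction w) (auto simp: h(2))
  then show thesis using that hom.group_hom_axioms by blast
qed

lemma foldr_step_alt_swap:
  "foldr (step (2 * k)) (alt_word Gen_s Gen_t (2 * k)) p =
   foldr (step (2 * k)) (alt_word Gen_t Gen_s (2 * k)) p"
  using foldr_step_Delta[of "2 * k" "fst p" Gen_s "snd p"]
    foldr_step_Delta[of "2 * k" "fst p" Gen_t "snd p"]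
    foldr_step_not_reduced[of "2 * k" "fst p" _ "snd p"] k
  by (cases "reduced (2 * k) (fst p)") auto

text \<open>Both sides are applied to \<open>([], 0)\<close>: a normal form sends this point to its
  own word and exponent.\<close>

lemma nf_unique:
  assumes "reduced (2 * k) w" "reduced (2 * k) w'"
    and eq: "wd w \<otimes> Dl [^] (n :: int) = wd w' \<otimes> Dl [^] (n' :: int)"
  shows "w = w'" "n = n'"
proof -
  have "bij (step (2 * k) g)" for g
    using k by (intro bij_step) auto
  then obtain h where "group_hom G perm_group h" and h: "\<And>w. h (wd w) = foldr (step (2 * k)) w"
    using perm_action foldr_step_alt_swap by metis
  then interpret hom: group_hom G perm_group h by blast
  have D1: "h Dl ([], i) = ([], i + 1)" for i
    using foldr_step_Delta[of "2 * k" "[]" Gen_s i] k by (simp add: Dl_def h)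
  have D: "h (Dl [^] i) ([], 0) = ([], i)" for i :: int
  proof (induction i rule: int_induct[where k = 0])
    case (step1 i)
    have "Dl [^] (i + 1) = Dl \<otimes> Dl [^] i"
      using int_pow_mult[of Dl 1 i] by (simp add: add.commute)
    then show ?case using step1 by (simp add: D1)
  next
    \<comment> \<open>Negative powers are not given by words; their value is found by applying
      \<Delta> once and using injectivity of \<open>h Dl\<close>.\<close>
    case (step2 i)
    have "Dl [^] i = Dl \<otimes> Dl [^] (i - 1)"
      using int_pow_mult[of Dl 1 "i - 1"] by simp
    then have "h Dl (h (Dl [^] (i - 1)) ([], 0)) = h Dl ([], i - 1)"
      using step2 by (simp add: D1)
    moreover have "bij (h Dl)"
      using hom.hom_closed[of Dl] by simp
    ultimately show ?case
      by (metis bij_is_inj injD)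
  qed simp
  have "h (wd u \<otimes> Dl [^] i) ([], 0) = (u, i)" if "reduced (2 * k) u" for u and i :: int
    using foldr_step_reduced[OF that] by (simp add: D) (simp add: h)
  from this[OF assms(1), of n] this[OF assms(2), of n'] eq show "w = w'" "n = n'"
    by auto
qed

lemma wd_inject: "reduced (2 * k) w \<Longrightarrow> reduced (2 * k) w' \<Longrightarrow> wd w = wd w' \<longleftrightarrow> w = w'"
  using nf_unique(1)[of w w' 0 0] by auto

section \<open>The positive monoid in terms of normal forms\<close>

lemma M_eq: "M = range wd"
proof
  have "submonoid (range wd) G"
  proof
    show "\<one> \<in> range wd" by (rule range_eqI[of _ _ "[]"]) simp
    show "x \<otimes> y \<in> range wd" if "x \<in> range wd" "y \<in> range wd" for x y
      using that by (auto simp flip: wd_append)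
  qed auto
  moreover have "gen g \<in> range wd" for g
    by (rule range_eqI[of _ _ "[g]"]) simp
  ultimately show "M \<subseteq> range wd"
    unfolding M_def submonoid_generated_def by blast
  show "range wd \<subseteq> M"
  proof
    fix a assume "a \<in> range wd"
    then obtain w where a: "a = wd w" by blast
    have "wd w \<in> K" if K: "submonoid K G" "{gen Gen_s, gen Gen_t} \<subseteq> K" for K
    proof (induction w)
      case (Cons g w)
      have "gen g \<in> K" using K(2) by (cases g) auto
      then show ?case using Cons submonoid.m_closed[OF K(1)] by simp
    qed (simp add: submonoid.one_closed[OF K(1)])
    then show "a \<in> M" by (simp add: a M_def submonoid_generated_def)
  qed
qed

lemma powers_eq: "powers g = range (\<lambda>n :: nat. gen g [^] n)"
proof
  have "submonoid (range (\<lambda>n :: nat. gen g [^] n)) G"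
  proof
    show "\<one> \<in> range (\<lambda>n :: nat. gen g [^] n)" by (rule range_eqI[of _ _ 0]) simp
    show "x \<otimes> y \<in> range (\<lambda>n :: nat. gen g [^] n)"
      if "x \<in> range (\<lambda>n :: nat. gen g [^] n)" "y \<in> range (\<lambda>n :: nat. gen g [^] n)" for x y
      using that by (auto simp: nat_pow_mult)
  qed auto
  moreover have "gen g \<in> range (\<lambda>n :: nat. gen g [^] n)"
    by (rule range_eqI[of _ _ 1]) simp
  ultimately show "powers g \<subseteq> range (\<lambda>n :: nat. gen g [^] n)"
    unfolding powers_def submonoid_generated_def by blast
  have "gen g [^] n \<in> K" if K: "submonoid K G" "gen g \<in> K" for K and n :: nat
    using K(2) by (induction n) (auto simp: submonoid.one_closed[OF K(1)] submonoid.m_closed[OF K(1)])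
  then show "range (\<lambda>n :: nat. gen g [^] n) \<subseteq> powers g"
    by (auto simp: powers_def submonoid_generated_def)
qed

lemma nf_in_M_iff:
  assumes "reduced (2 * k) w"
  shows "wd w \<otimes> Dl [^] (n :: int) \<in> M \<longleftrightarrow> 0 \<le> n"
proof
  assume "wd w \<otimes> Dl [^] n \<in> M"
  then obtain v where v: "wd w \<otimes> Dl [^] n = wd v" by (auto simp: M_eq)
  obtain w' n' where "reduced (2 * k) w'" "wd v = wd w' \<otimes> Dl [^] (n' :: int)" "0 \<le> n'"
    by (rule nf_exists_positive)
  then show "0 \<le> n" using nf_unique(2)[OF assms] v by metis
next
  assume "0 \<le> n"
  then obtain l where n: "n = int l" using nonneg_int_cases by blast
  have "Dl [^] l = wd (concat (replicate l (alt_word Gen_s Gen_t (2 * k))))"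
    by (induction l) (simp_all add: wd_append Dl_def[symmetric] Dl_central)
  then show "wd w \<otimes> Dl [^] n \<in> M"
    by (auto simp: n int_pow_int M_eq simp flip: wd_append)
qed

text \<open>Division by \<Delta> lowers the exponent of the normal form by one, so it leaves
  \<open>M\<close> exactly when that exponent is 0.\<close>

lemma unmovable_iff: "unmovable G M Dl a \<longleftrightarrow> (\<exists>w. reduced (2 * k) w \<and> a = wd w)"
proof
  assume a: "unmovable G M Dl a"
  then obtain v where "a = wd v" by (auto simp: unmovable_def M_eq)
  then obtain w n where w: "reduced (2 * k) w" "a = wd w \<otimes> Dl [^] (n :: int)" "0 \<le> n"
    using nf_exists_positive by metis
  have "a \<otimes> inv Dl = wd w \<otimes> Dl [^] (n - 1)"
    by (simp add: w(2) m_assoc int_pow_diff)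
  then have "n = 0"
    using w(3) a nf_in_M_iff[OF w(1), of "n - 1"] by (simp add: unmovable_def le_R_def)
  then show "\<exists>w. reduced (2 * k) w \<and> a = wd w" using w by auto
next
  assume "\<exists>w. reduced (2 * k) w \<and> a = wd w"
  then obtain w where w: "reduced (2 * k) w" "a = wd w" by blast
  have "a \<otimes> inv Dl = wd w \<otimes> Dl [^] (- 1 :: int)"
    by (simp add: w(2) int_pow_neg)
  then show "unmovable G M Dl a"
    using nf_in_M_iff[OF w(1), of "- 1"] w(2) by (simp add: unmovable_def le_R_def M_eq)
qed

end


section \<open>Alternating forms and depth\<close>

lemma (in monoid) foldr_mult_one:
  assumes "\<And>j. j \<in> set l \<Longrightarrow> x j \<in> carrier G" "b \<in> carrier G"
  shows "foldr (\<lambda>j y. x j \<otimes> y) l b = foldr (\<lambda>j y. x j \<otimes> y) l \<one> \<otimes> b"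
proof -
  have c: "foldr (\<lambda>j y. x j \<otimes> y) l' \<one> \<in> carrier G" if "set l' \<subseteq> set l" for l'
    using that assms(1) by (induction l') auto
  have "foldr (\<lambda>j y. x j \<otimes> y) l' b = foldr (\<lambda>j y. x j \<otimes> y) l' \<one> \<otimes> b" if "set l' \<subseteq> set l" for l'
    using that
  proof (induction l')
    case (Cons j l')
    then show ?case using assms c[of l'] by (simp add: m_assoc)
  qed (use assms in simp)
  then show ?thesis by blast
qed

lemma (in monoid) desc_prod_rec:
  assumes "i \<le> p" "\<And>j. i \<le> j \<Longrightarrow> j \<le> p \<Longrightarrow> x j \<in> carrier G"
  shows "desc_prod G x p i = desc_prod G x p (Suc i) \<otimes> x i"
proof -
  have "rev [i..<Suc p] = rev [Suc i..<Suc p] @ [i]"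
    using assms(1) upt_conv_Cons[of i "Suc p"] by simp
  then have "desc_prod G x p i = foldr (\<lambda>j y. x j \<otimes> y) (rev [Suc i..<Suc p]) (x i \<otimes> \<one>)"
    by (simp add: desc_prod_def)
  also have "\<dots> = desc_prod G x p (Suc i) \<otimes> x i"
    unfolding desc_prod_def using assms by (subst foldr_mult_one) auto
  finally show ?thesis .
qed

lemma (in monoid) desc_prod_closed:
  assumes "\<And>j. i \<le> j \<Longrightarrow> j \<le> p \<Longrightarrow> x j \<in> carrier G"
  shows "desc_prod G x p i \<in> carrier G"
proof -
  have "foldr (\<lambda>j y. x j \<otimes> y) l \<one> \<in> carrier G" if "\<forall>j\<in>set l. x j \<in> carrier G" for l
    using that by (induction l) auto
  then show ?thesis using assms by (simp add: desc_prod_def)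
qed

lemma desc_prod_shift:
  "desc_prod G x (Suc p) (Suc i) = desc_prod G (\<lambda>j. x (Suc j)) p i"
proof -
  have "rev [Suc i..<Suc (Suc p)] = map Suc (rev [i..<Suc p])"
    by (simp only: rev_map[symmetric] map_Suc_upt)
  then show ?thesis by (simp only: desc_prod_def foldr_map o_def)
qed

lemma desc_prod_cong:
  assumes "\<And>j. i \<le> j \<Longrightarrow> j \<le> p \<Longrightarrow> x j = y j"
  shows "desc_prod G x p i = desc_prod G y p i"
  unfolding desc_prod_def by (rule foldr_cong) (use assms in auto)

lemma desc_prod_top: "desc_prod G x p (Suc p) = \<one>\<^bsub>G\<^esub>"
  by (simp add: desc_prod_def)

text \<open>Only the length of the form stays visible, and \<open>K\<close>, \<open>L\<close> are
  free so that a recursion can exchange them.\<close>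

definition has_alt_form ::
    "('g, 'z) monoid_scheme \<Rightarrow> 'g set \<Rightarrow> 'g set \<Rightarrow> 'g set \<Rightarrow> 'g \<Rightarrow> nat \<Rightarrow> bool" where
  "has_alt_form G M K L a p \<longleftrightarrow> (\<exists>x. is_alternating_form G M K L a p x)"

lemma has_alt_form_0: "\<not> has_alt_form G M K L a 0"
  by (simp add: has_alt_form_def is_alternating_form_def)

lemma (in monoid) has_alt_form_1:
  assumes "M \<subseteq> carrier G"
  shows "has_alt_form G M K L a (Suc 0) \<longleftrightarrow> a \<in> M \<and> a \<noteq> \<one> \<and> tail G M K a = a"
proof
  assume "has_alt_form G M K L a (Suc 0)"
  then obtain x where x: "is_alternating_form G M K L a (Suc 0) x"
    by (auto simp: has_alt_form_def)
  then have "x 1 \<in> carrier G" using assms by (auto simp: is_alternating_form_def)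
  then have "desc_prod G x (Suc 0) 1 = x 1"
    using desc_prod_rec[of 1 "Suc 0" x] desc_prod_top[of G x 1] by simp
  then show "a \<in> M \<and> a \<noteq> \<one> \<and> tail G M K a = a"
    using x by (auto simp: is_alternating_form_def)
next
  assume a: "a \<in> M \<and> a \<noteq> \<one> \<and> tail G M K a = a"
  have "desc_prod G (\<lambda>_. a) (Suc 0) 1 = a"
    using desc_prod_rec[of 1 "Suc 0" "\<lambda>_. a"] desc_prod_top[of G _ 1] a assms by auto
  then show "has_alt_form G M K L a (Suc 0)"
    unfolding has_alt_form_def is_alternating_form_def using a
    by (intro exI[of _ "\<lambda>_. a"]) auto
qed

text \<open>The rightmost factor is the tail of \<open>a\<close>; removing it shifts all indices by
  one, which flips parities and so swaps \<open>K\<close> and \<open>L\<close>.\<close>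

lemma (in monoid) has_alt_form_Suc:
  assumes M: "M \<subseteq> carrier G" and p: "1 \<le> p"
  shows "has_alt_form G M K L a (Suc p) \<longleftrightarrow>
    tail G M K a \<in> M \<and> (\<exists>a'\<in>carrier G. a = a' \<otimes> tail G M K a \<and> has_alt_form G M L K a' p)"
proof
  assume "has_alt_form G M K L a (Suc p)"
  then obtain x where x: "is_alternating_form G M K L a (Suc p) x"
    by (auto simp: has_alt_form_def)
  let ?y = "\<lambda>j. x (Suc j)"
  have "\<forall>i\<in>{1..Suc p}. x i \<in> M"
    using x unfolding is_alternating_form_def by blast
  then have xM: "x i \<in> M" if "1 \<le> i" "i \<le> Suc p" for i
    using that by simp
  have x1: "x 1 = tail G M K a"
    using x by (auto simp: is_alternating_form_def)
  have "a = desc_prod G x (Suc p) 1"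
    using x by (auto simp: is_alternating_form_def)
  also have "\<dots> = desc_prod G x (Suc p) (Suc 1) \<otimes> x 1"
    by (rule desc_prod_rec) (use xM M in auto)
  finally have a: "a = desc_prod G ?y p 1 \<otimes> x 1"
    by (simp add: desc_prod_shift)
  have closed: "desc_prod G ?y p 1 \<in> carrier G"
    by (rule desc_prod_closed) (use xM M in auto)
  have "is_alternating_form G M L K (desc_prod G ?y p 1) p ?y"
    unfolding is_alternating_form_def
  proof (intro conjI ballI)
    fix i assume i: "i \<in> {1..p}"
    show "?y i \<in> M" using i by (intro xM) auto
    have "x (Suc i) = tail G M (if odd (Suc i) then K else L) (desc_prod G x (Suc p) (Suc i))"
      using x i unfolding is_alternating_form_def by simp
    then show "?y i = tail G M (if odd i then L else K) (desc_prod G ?y p i)"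
      by (simp add: desc_prod_shift split: if_splits)
  qed (use x p in \<open>auto simp: is_alternating_form_def\<close>)
  then show "tail G M K a \<in> M \<and> (\<exists>a'\<in>carrier G. a = a' \<otimes> tail G M K a \<and> has_alt_form G M L K a' p)"
    using a x1 xM[of 1] closed by (auto simp: has_alt_form_def)
next
  assume "tail G M K a \<in> M \<and> (\<exists>a'\<in>carrier G. a = a' \<otimes> tail G M K a \<and> has_alt_form G M L K a' p)"
  then obtain a' y where t: "tail G M K a \<in> M" and a: "a = a' \<otimes> tail G M K a"
    and y: "is_alternating_form G M L K a' p y"
    by (auto simp: has_alt_form_def)
  define x where "x i = (if i \<le> 1 then tail G M K a else y (i - 1))" for i
  have sh: "desc_prod G x (Suc p) (Suc i) = desc_prod G y p i" if "1 \<le> i" for i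
    unfolding desc_prod_shift by (rule desc_prod_cong) (use that in \<open>auto simp: x_def\<close>)
  have "\<forall>i\<in>{1..p}. y i \<in> M"
    using y unfolding is_alternating_form_def by blast
  then have xM: "x i \<in> M" if "1 \<le> i" "i \<le> Suc p" for i
    using that t by (cases i) (auto simp: x_def)
  have "desc_prod G x (Suc p) 1 = desc_prod G x (Suc p) (Suc 1) \<otimes> x 1"
    by (rule desc_prod_rec) (use xM M in auto)
  then have a1: "desc_prod G x (Suc p) 1 = a"
    using a y sh[of 1] by (simp add: x_def is_alternating_form_def)
  have "is_alternating_form G M K L a (Suc p) x"
    unfolding is_alternating_form_def
  proof (intro conjI ballI)
    fix i assume i: "i \<in> {1..Suc p}"
    show "x i \<in> M" using i xM by simp
    show "x i = tail G M (if odd i then K else L) (desc_prod G x (Suc p) i)"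
    proof (cases "i = 1")
      case True
      then show ?thesis using a1 by (simp add: x_def)
    next
      case False
      then obtain j where j: "i = Suc j" "1 \<le> j" using i by (cases i) auto
      have "y j = tail G M (if odd j then L else K) (desc_prod G y p j)"
        using y i j by (auto simp: is_alternating_form_def)
      then show ?thesis using j sh[of j] by (auto simp: x_def)
    qed
  qed (use a1 y p in \<open>auto simp: x_def is_alternating_form_def\<close>)
  then show "has_alt_form G M K L a (Suc p)" by (auto simp: has_alt_form_def)
qed

text \<open>Syllable exponents are listed from right to left, matching alternating forms, whose
  first factor is the rightmost.\<close>

fun blocks :: "artin_gen \<Rightarrow> nat list \<Rightarrow> artin_gen list" where
  "blocks g [] = []"
| "blocks g (e # es) = blocks (flip g) es @ replicate e g"

lemma last_blocks: "es \<noteq> [] \<Longrightarrow> \<forall>e\<in>set es. 0 < e \<Longrightarrow> blocks g es \<noteq> [] \<and> last (blocks g es) = g"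
  by (cases es) auto

lemma split_trailing:
  obtains u e where "w = u @ replicate e g" "u = [] \<or> last u \<noteq> g"
proof -
  have "\<exists>u e. w = u @ replicate e g \<and> (u = [] \<or> last u \<noteq> g)"
  proof (induction w rule: rev_induct)
    case (snoc h w)
    show ?case
    proof (cases "h = g")
      case True
      from snoc obtain u e where "w = u @ replicate e g" "u = [] \<or> last u \<noteq> g" by blast
      then show ?thesis
        using True by (intro exI[of _ u] exI[of _ "Suc e"]) (simp add: replicate_append_same)
    next
      case False
      then show ?thesis by (intro exI[of _ "w @ [h]"] exI[of _ 0]) simp
    qed
  qed simp
  then show thesis using that by blast
qed

lemma blocks_exist:
  assumes "w = [] \<or> last w = g"
  obtains es where "w = blocks g es" "\<forall>e\<in>set es. 0 < e"
proof -
  have "\<exists>es. w = blocks g es \<and> (\<forall>e\<in>set es. 0 < e)"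
    using assms
  proof (induction w arbitrary: g rule: length_induct)
    case (1 w)
    show ?case
    proof (cases "w = []")
      case True
      then show ?thesis by (intro exI[of _ "[]"]) simp
    next
      case False
      obtain u e where u: "w = u @ replicate e g" "u = [] \<or> last u \<noteq> g"
        using split_trailing .
      have e: "0 < e" using u False 1(2) by (cases e) auto
      then have "length u < length w" using u(1) by simp
      moreover have "u = [] \<or> last u = flip g" using u(2) neq_iff_flip by blast
      ultimately obtain es where "u = blocks (flip g) es" "\<forall>e\<in>set es. 0 < e"
        using 1(1) by blast
      then show ?thesis using e u(1) by (intro exI[of _ "e # es"]) simp
    qed
  qed
  then show thesis using that by blast
qed

text \<open>A maximal block of letters \<open>Gen_s\<close> is counted at its last letter.\<close>

fun s_syllables :: "artin_gen list \<Rightarrow> nat" where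
  "s_syllables [] = 0"
| "s_syllables (g # w) =
    (if g = Gen_s \<and> (w = [] \<or> hd w = Gen_t) then Suc (s_syllables w) else s_syllables w)"

lemma s_syllables_append:
  "s_syllables (u @ v) + (if u \<noteq> [] \<and> v \<noteq> [] \<and> last u = Gen_s \<and> hd v = Gen_s then 1 else 0) =
    s_syllables u + s_syllables v"
proof (induction u)
  case (Cons g u)
  then show ?case
    using neq_iff_flip[of _ Gen_t] by (cases "u = []"; cases "v = []") (auto split: if_splits)
qed simp

lemma hd_replicate_if: "hd (replicate e g) = (if e = 0 then hd [] else g)"
  by (cases e) auto

lemma s_syllables_replicate:
  "s_syllables (replicate e g) = (if g = Gen_s \<and> 0 < e then 1 else 0)"
  by (induction e) (auto simp: hd_replicate_if)

lemma s_syllables_append_ts [simp]: "s_syllables (u @ replicate e Gen_t) = s_syllables u"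
  using s_syllables_append[of u "replicate e Gen_t"] by (cases e) (auto simp: s_syllables_replicate)

lemma s_syllables_blocks:
  assumes "\<forall>e\<in>set es. 0 < e"
  shows "s_syllables (blocks g es) = (if g = Gen_s then length es + 1 else length es) div 2"
  using assms
proof (induction es arbitrary: g)
  case (Cons e es)
  have IH: "s_syllables (blocks (flip g) es) = (if flip g = Gen_s then length es + 1 else length es) div 2"
    using Cons by auto
  show ?case
  proof (cases g)
    case Gen_t
    then show ?thesis using IH by simp
  next
    case Gen_s
    have "\<not> (blocks Gen_t es \<noteq> [] \<and> last (blocks Gen_t es) = Gen_s)"
      using last_blocks[of es Gen_t] Cons.prems by (cases es) auto
    then show ?thesis
      using IH Gen_s Cons.prems s_syllables_append[of "blocks Gen_t es" "replicate e Gen_s"]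
      by (auto simp: s_syllables_replicate split: if_splits)
  qed
qed simp

lemma s_syllables_alt_word:
  "s_syllables (alt_word Gen_s Gen_t i) = (i + 1) div 2"
  "s_syllables (alt_word Gen_t Gen_s i) = i div 2"
proof (induction i)
  case (Suc i)
  { case 1 then show ?case using Suc by (cases i) auto }
  { case 2 then show ?case using Suc by (cases i) auto }
qed auto

section \<open>Tails and depth of normal forms and of powers of \<Delta>\<close>

context artin_even
begin

text \<open>The word \<open>neg_word g l\<close> represents \<open>\<Delta>\<^sup>l g\<^sup>-\<^sup>l\<close>.\<close>

definition neg_word :: "artin_gen \<Rightarrow> nat \<Rightarrow> artin_gen list" where
  "neg_word g l = concat (replicate l (alt_word (flip g) g (2 * k - Suc 0)))"

lemma alt_word_odd_ends:
  "alt_word (flip g) g (2 * k - Suc 0) \<noteq> []"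
  "hd (alt_word (flip g) g (2 * k - Suc 0)) = flip g"
  "last (alt_word (flip g) g (2 * k - Suc 0)) = flip g"
proof -
  obtain j where j: "2 * k - Suc 0 = Suc (2 * j)"
    by (rule that[of "k - 1"]) (use k in simp)
  show "alt_word (flip g) g (2 * k - Suc 0) \<noteq> []"
    "hd (alt_word (flip g) g (2 * k - Suc 0)) = flip g"
    unfolding j by simp_all
  show "last (alt_word (flip g) g (2 * k - Suc 0)) = flip g"
    unfolding j alt_word_snoc by simp
qed

lemma neg_word_ends:
  "0 < l \<Longrightarrow> neg_word g l \<noteq> []"
  "neg_word g l = [] \<or> hd (neg_word g l) = flip g"
  "neg_word g l = [] \<or> last (neg_word g l) = flip g"
proof -
  show "0 < l \<Longrightarrow> neg_word g l \<noteq> []"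
    by (cases l) (auto simp: neg_word_def alt_word_odd_ends)
  show "neg_word g l = [] \<or> hd (neg_word g l) = flip g"
    by (cases l) (auto simp: neg_word_def alt_word_odd_ends)
  show "neg_word g l = [] \<or> last (neg_word g l) = flip g"
    by (induction l) (auto simp: neg_word_def last_append alt_word_odd_ends)
qed

text \<open>Adjacent copies of the alternating word meet in two equal letters \<open>flip g\<close>,
  so no run crosses a junction.\<close>

lemma reduced_neg_word: "reduced (2 * k) (neg_word g l)"
proof (induction l)
  case (Suc l)
  have "reduced (2 * k) (alt_word (flip g) g (2 * k - Suc 0) @ neg_word g l)"
    by (rule reduced_append)
      (use Suc k neg_word_ends(2)[of g l] in \<open>auto simp: alt_word_odd_ends intro: reduced_alt_word\<close>)
  then show ?case by (simp add: neg_word_def)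
qed (simp add: neg_word_def)

lemma wd_neg_word: "wd (neg_word g l) \<otimes> gen g [^] l = Dl [^] l"
proof (induction l)
  case (Suc l)
  let ?A = "alt_word (flip g) g (2 * k - Suc 0)"
  have "odd (2 * k - Suc 0)" "2 * k = Suc (2 * k - Suc 0)" using k by auto
  then have A: "wd ?A \<otimes> gen g = Dl"
    using wd_alt[of "flip g"] alt_word_snoc[of "flip g" g "2 * k - Suc 0"]
    by (simp add: wd_append del: alt_word.simps)
  have "wd (neg_word g (Suc l)) \<otimes> gen g [^] Suc l = wd ?A \<otimes> (wd (neg_word g l) \<otimes> gen g [^] l) \<otimes> gen g"
    by (simp add: neg_word_def wd_append m_assoc)
  also have "\<dots> = (wd ?A \<otimes> gen g) \<otimes> Dl [^] l"
    by (simp add: Suc m_assoc Dl_nat_pow_central)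
  finally show ?case
    unfolding A by (simp add: Dl_central)
qed (simp add: neg_word_def)

lemma M_closed: "M \<subseteq> carrier G"
  by (auto simp: M_eq)

text \<open>For \<open>l > e\<close> the quotient is \<open>w\<close> times a negative power of
  \<open>g\<close>. Rewriting that power with \<open>neg_word\<close> gives a normal form, reduced
  because the two words meet in equal letters \<open>flip g\<close>, and its exponent is
  negative.\<close>

lemma le_R_power_iff:
  assumes w: "reduced (2 * k) w" "w = [] \<or> last w = flip g"
  shows "le_R G M (gen g [^] (l :: nat)) (wd w \<otimes> gen g [^] (e :: nat)) \<longleftrightarrow> l \<le> e"
proof (cases "l \<le> e")
  case True
  then have "gen g [^] e = gen g [^] (e - l) \<otimes> gen g [^] l"
    by (simp add: nat_pow_mult)
  then have "wd w \<otimes> gen g [^] e \<otimes> inv (gen g [^] l) = wd w \<otimes> gen g [^] (e - l)"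
    by (simp add: m_assoc)
  also have "\<dots> = wd (w @ replicate (e - l) g)"
    by (simp add: wd_append wd_replicate)
  finally show ?thesis using True by (simp add: le_R_def M_eq)
next
  case False
  define r where "r = l - e"
  then have r: "0 < r" "l = r + e" using False by auto
  have "gen g [^] l = gen g [^] r \<otimes> gen g [^] e"
    by (simp add: r(2) nat_pow_mult)
  then have "wd w \<otimes> gen g [^] e \<otimes> inv (gen g [^] l) = wd w \<otimes> inv (gen g [^] r)"
    by (simp add: inv_mult_group m_assoc) (simp flip: m_assoc)
  also have "inv (gen g [^] r) = wd (neg_word g r) \<otimes> Dl [^] (- int r)"
  proof -
    have "wd (neg_word g r) = Dl [^] r \<otimes> inv (gen g [^] r)"
      using wd_neg_word[of g r] by (simp add: inv_solve_right)
    then show ?thesis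
      by (simp add: int_pow_neg_int Dl_nat_pow_central m_assoc)
  qed
  finally have "wd w \<otimes> gen g [^] e \<otimes> inv (gen g [^] l) = wd (w @ neg_word g r) \<otimes> Dl [^] (- int r)"
    by (simp add: wd_append m_assoc)
  moreover have "reduced (2 * k) (w @ neg_word g r)"
    by (rule reduced_append) (use w reduced_neg_word neg_word_ends(2)[of g r] in auto)
  ultimately show ?thesis
    using nf_in_M_iff r(1) False by (simp add: le_R_def)
qed

text \<open>Only \<open>w\<close> has to be reduced, not \<open>w\<close> followed by
  \<open>e\<close> letters \<open>g\<close>; this is what makes powers of \<Delta> accessible
  too.\<close>

lemma tail_power:
  assumes w: "reduced (2 * k) w" "w = [] \<or> last w = flip g"
  shows "tail G M (powers g) (wd w \<otimes> gen g [^] (e :: nat)) = gen g [^] e"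
  unfolding tail_def
proof (rule the_equality)
  have pow: "{c \<in> powers g. le_R G M c (wd w \<otimes> gen g [^] (e :: nat))} = {gen g [^] l | l. l \<le> e}"
    if "reduced (2 * k) w" "w = [] \<or> last w = flip g" for w e
    using le_R_power_iff[OF that] by (auto simp: powers_eq)
  have pow1: "{c \<in> powers g. le_R G M c (gen g [^] (e :: nat))} = {gen g [^] l | l. l \<le> e}" for e
    using pow[of "[]" e] by simp
  show "gen g [^] e \<in> powers g \<and> {c \<in> powers g. le_R G M c (wd w \<otimes> gen g [^] e)} =
      {c \<in> powers g. le_R G M c (gen g [^] e)}"
    using pow[OF w, of e] pow1[of e] by (simp add: powers_eq)
  fix b
  assume b: "b \<in> powers g \<and> {c \<in> powers g. le_R G M c (wd w \<otimes> gen g [^] e)} =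
      {c \<in> powers g. le_R G M c b}"
  then obtain i :: nat where i: "b = gen g [^] i" by (auto simp: powers_eq)
  have iff: "le_R G M (gen g [^] l) (gen g [^] i) \<longleftrightarrow> le_R G M (gen g [^] l) (wd w \<otimes> gen g [^] e)"
    for l :: nat
    using b by (auto simp: i powers_eq)
  have "l \<le> i \<longleftrightarrow> l \<le> e" for l
    using iff[of l] le_R_power_iff[OF w, of l e] le_R_power_iff[of "[]" g l i] by simp
  then have "i = e" by (meson dual_order.antisym order_refl)
  then show "b = gen g [^] e" by (simp add: i)
qed

lemma not_has_alt_form_one: "\<not> has_alt_form G M (powers g) (powers h) \<one> p"
proof (induction p arbitrary: g h)
  case (Suc p)
  have "tail G M (powers g) \<one> = \<one>"
    using tail_power[of "[]" g 0] by simp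
  then show ?case
    using Suc has_alt_form_Suc[OF M_closed, of p "powers g" "powers h" \<one>]
      has_alt_form_1[OF M_closed, of "powers g" "powers h" \<one>]
    by (cases "p = 0") (auto simp: has_alt_form_def is_alternating_form_def desc_prod_def)
qed (simp add: has_alt_form_0)

lemma has_alt_form_power_Suc:
  assumes w: "reduced (2 * k) w" "w = [] \<or> last w = flip g" and p: "1 \<le> p"
  shows "has_alt_form G M (powers g) L (wd w \<otimes> gen g [^] (e :: nat)) (Suc p) \<longleftrightarrow>
    has_alt_form G M L (powers g) (wd w) p"
proof -
  have "gen g [^] e \<in> M" by (auto simp: M_eq simp flip: wd_replicate)
  moreover have "wd w \<otimes> gen g [^] e = a' \<otimes> gen g [^] e \<longleftrightarrow> wd w = a'" if "a' \<in> carrier G" for a'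
    using that right_cancel[of "wd w" "gen g [^] e" a'] by simp
  ultimately show ?thesis
    unfolding has_alt_form_Suc[OF M_closed p] tail_power[OF w] by auto
qed

text \<open>Each syllable is the tail of what remains once the syllables to its right are removed.
  The rightmost factor counts even when \<open>e = 0\<close>, since only the top factor of a form
  must be nontrivial.\<close>

lemma has_alt_form_blocks:
  assumes "\<forall>e\<in>set es. 0 < e" "reduced (2 * k) (blocks (flip g) es)" "es \<noteq> [] \<or> 0 < e"
  shows "has_alt_form G M (powers g) (powers (flip g)) (wd (blocks (flip g) es) \<otimes> gen g [^] (e :: nat)) p
    \<longleftrightarrow> p = length es + 1"
  using assms
proof (induction es arbitrary: g e p)
  case Nil
  have t: "tail G M (powers g) (gen g [^] e) = gen g [^] e"
    using tail_power[of "[]" g e] by simp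
  have M: "gen g [^] e \<in> M" by (auto simp: M_eq simp flip: wd_replicate)
  have "wd (replicate e g) \<noteq> wd []"
    using wd_inject[of "replicate e g" "[]"] reduced_replicate[of "2 * k" e g] k Nil.prems by auto
  then have ne: "gen g [^] e \<noteq> \<one>" by (simp add: wd_replicate)
  consider "p = 0" | "p = Suc 0" | q where "p = Suc q" "1 \<le> q"
    by (cases p; cases "p = 1") auto
  then show ?case
  proof cases
    case 3
    then show ?thesis
      using has_alt_form_power_Suc[of "[]" g q _ e] not_has_alt_form_one by simp
  qed (use t M ne has_alt_form_1[OF M_closed] in \<open>auto simp: has_alt_form_0\<close>)
next
  case (Cons e1 es)
  let ?w = "blocks (flip g) (e1 # es)"
  have w: "?w \<noteq> []" "last ?w = flip g"
    using last_blocks[of "e1 # es" "flip g"] Cons.prems(1) by auto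
  consider "p = 0" | "p = Suc 0" | q where "p = Suc q" "1 \<le> q"
    by (cases p; cases "p = 1") auto
  then show ?case
  proof cases
    case 2
    have "wd ?w \<noteq> wd []"
      using wd_inject[of ?w "[]"] Cons.prems(2) w(1) by simp
    then have "gen g [^] e \<noteq> wd ?w \<otimes> gen g [^] e"
      using l_cancel_one'[of "gen g [^] e" "wd ?w"] r_cancel_one'[of "gen g [^] e" "wd ?w"] by simp
    then show ?thesis
      using 2 has_alt_form_1[OF M_closed] tail_power[of ?w g e] Cons.prems(2) w by auto
  next
    case 3
    have "reduced (2 * k) (blocks (flip (flip g)) es)"
      using Cons.prems(2) reduced_appendI1[of _ "blocks g es"] by auto
    then have "has_alt_form G M (powers (flip g)) (powers g) (wd ?w) q \<longleftrightarrow> q = length es + 1"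
      using Cons.IH[of "flip g" e1 q] Cons.prems(1) by (simp add: wd_append wd_replicate)
    then show ?thesis
      using 3 has_alt_form_power_Suc[of ?w g q "powers (flip g)" e] Cons.prems(2) w by simp
  qed (simp add: has_alt_form_0)
qed

text \<open>The form has one factor per syllable of \<open>w\<close> and one for the power of
  \<open>t\<close>; in both parity cases the depth then counts the odd positions in
  \<open>es\<close>, which are the syllables \<open>s\<close>.\<close>

lemma dpt_nf:
  assumes w: "reduced (2 * k) w" "w = [] \<or> last w = Gen_s"
  shows "dpt G M (powers Gen_t) (powers Gen_s) (wd w \<otimes> gen Gen_t [^] (e :: nat)) = s_syllables w"
proof -
  obtain es where es: "w = blocks Gen_s es" "\<forall>e\<in>set es. 0 < e"
    using blocks_exist[OF w(2)] .
  have "bh G M (powers Gen_t) (powers Gen_s) (wd w \<otimes> gen Gen_t [^] e) = length es + 1"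
  proof (cases "es = [] \<and> e = 0")
    \<comment> \<open>The identity: the convention that its breadth is 1 agrees with the empty list
      of syllables.\<close>
    case True
    then show ?thesis using es by (simp add: bh_def)
  next
    case False
    have iff: "has_alt_form G M (powers Gen_t) (powers Gen_s) (wd w \<otimes> gen Gen_t [^] e) p
        \<longleftrightarrow> p = length es + 1" for p
      using has_alt_form_blocks[of es Gen_t e p] False es w(1) by auto
    then have "wd w \<otimes> gen Gen_t [^] e \<noteq> \<one>"
      using not_has_alt_form_one by metis
    then show ?thesis
      using iff by (simp add: bh_def has_alt_form_def)
  qed
  then show ?thesis
    using s_syllables_blocks[OF es(2), of Gen_s] es(1) by (auto simp: dpt_def)
qed

lemma dpt_wd:
  assumes "reduced (2 * k) w"
  shows "dpt G M (powers Gen_t) (powers Gen_s) (wd w) = s_syllables w"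
proof -
  obtain u e where u: "w = u @ replicate e Gen_t" "u = [] \<or> last u \<noteq> Gen_t"
    using split_trailing .
  have "u = [] \<or> last u = Gen_s" using u(2) neq_iff_flip[of _ Gen_t] by simp
  moreover have "reduced (2 * k) u" using assms u(1) reduced_appendI1 by blast
  ultimately show ?thesis
    using dpt_nf[of u e] u(1) by (simp add: wd_append wd_replicate)
qed

text \<open>Each alternating factor has \<open>k\<close> syllables \<open>s\<close>, and each
  junction merges two of them: \<open>n\<close> factors give
  \<open>n * k - (n - 1) = n * (k - 1) + 1\<close>.\<close>

lemma s_syllables_neg_word: "s_syllables (neg_word Gen_t (Suc l)) = Suc l * (k - 1) + 1"
proof (induction l)
  case 0
  show ?case using k by (simp add: neg_word_def s_syllables_alt_word)
next
  case (Suc l)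
  let ?A = "alt_word Gen_s Gen_t (2 * k - Suc 0)"
  have "s_syllables (?A @ neg_word Gen_t (Suc l)) + 1 = k + s_syllables (neg_word Gen_t (Suc l))"
    using s_syllables_append[of ?A "neg_word Gen_t (Suc l)"] alt_word_odd_ends[of Gen_t]
      neg_word_ends(1)[of "Suc l" Gen_t] neg_word_ends(2)[of Gen_t "Suc l"] k by (simp add: s_syllables_alt_word)
  moreover have "neg_word Gen_t (Suc (Suc l)) = ?A @ neg_word Gen_t (Suc l)"
    by (simp add: neg_word_def)
  ultimately have "s_syllables (neg_word Gen_t (Suc (Suc l))) + 1 = k + (Suc l * (k - 1) + 1)"
    by (simp only: Suc.IH)
  moreover have "Suc (Suc l) * (k - 1) = (k - 1) + Suc l * (k - 1)"
    by simp
  ultimately show ?case using k by linarith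
qed

lemma dpt_Dl_pow:
  assumes "1 \<le> (j :: int)"
  shows "int (dpt G M (powers Gen_t) (powers Gen_s) (Dl [^] j)) = j * (int k - 1) + 1"
proof -
  obtain l where l: "j = int (Suc l)"
    using assms by (metis Suc_pred nonneg_int_cases of_nat_0_less_iff order_less_le_trans zero_less_one order.strict_implies_order)
  \<comment> \<open>This factorization has the shape required by \<open>dpt_nf\<close>, although
    \<Delta> itself is movable.\<close>
  have "Dl [^] j = wd (neg_word Gen_t (Suc l)) \<otimes> gen Gen_t [^] Suc l"
    unfolding wd_neg_word l int_pow_int ..
  then have "dpt G M (powers Gen_t) (powers Gen_s) (Dl [^] j) = Suc l * (k - 1) + 1"
    using dpt_nf[of "neg_word Gen_t (Suc l)" "Suc l"] reduced_neg_word[of Gen_t "Suc l"] neg_word_ends(3)[of Gen_t "Suc l"]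
    by (simp only: s_syllables_neg_word flip.simps)
  moreover have "int (k - 1) = int k - 1" using k by simp
  ultimately show ?thesis
    by (simp only: l of_nat_add of_nat_mult of_nat_1)
qed

end


section \<open>The action on the real line\<close>

text \<open>\<open>twist c\<close> commutes with the translation by 1, fixes the integers, and maps
  \<open>[0, 1/c]\<close> onto \<open>[0, 1 - 1/c]\<close> and \<open>[1/c, 1]\<close> onto \<open>[1 - 1/c, 1]\<close> linearly.\<close>

definition twist :: "real \<Rightarrow> real \<Rightarrow> real" where
  "twist c u = of_int \<lfloor>u\<rfloor> + min ((c - 1) * frac u) (1 - (1 - frac u) / (c - 1))"

definition untwist :: "real \<Rightarrow> real \<Rightarrow> real" where
  "untwist c u = of_int \<lfloor>u\<rfloor> + max (frac u / (c - 1)) (1 - (c - 1) * (1 - frac u))"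

lemma floor_add_unit:
  fixes v :: real
  assumes "0 \<le> v" "v < 1"
  shows "\<lfloor>of_int n + v\<rfloor> = n" "frac (of_int n + v) = v"
  using assms by (auto simp: frac_def) linarith+

text \<open>Offsets in \<open>[0, 1)\<close> stay there, so \<open>twist\<close> and
  \<open>untwist\<close> preserve integer parts.\<close>

lemma twist_offset:
  fixes c v :: real
  assumes "2 < c" "0 \<le> v" "v < 1"
  shows "0 \<le> min ((c - 1) * v) (1 - (1 - v) / (c - 1))"
    "min ((c - 1) * v) (1 - (1 - v) / (c - 1)) < 1"
    "0 \<le> max (v / (c - 1)) (1 - (c - 1) * (1 - v))"
    "max (v / (c - 1)) (1 - (c - 1) * (1 - v)) < 1"
proof -
  have "0 < (1 - v) / (c - 1)" "(1 - v) / (c - 1) \<le> 1" "0 \<le> v / (c - 1)" "v / (c - 1) < 1"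
    "0 \<le> (c - 1) * v" "0 < (c - 1) * (1 - v)"
    using assms by (auto simp: divide_simps)
  then show "0 \<le> min ((c - 1) * v) (1 - (1 - v) / (c - 1))"
    "min ((c - 1) * v) (1 - (1 - v) / (c - 1)) < 1"
    "0 \<le> max (v / (c - 1)) (1 - (c - 1) * (1 - v))"
    "max (v / (c - 1)) (1 - (c - 1) * (1 - v)) < 1"
    by linarith+
qed

text \<open>The inverse of the minimum of two increasing maps is the maximum of their inverses;
  \<open>A\<close> and \<open>B\<close> are the two linear branches.\<close>

lemma untwist_twist:
  assumes "2 < c"
  shows "untwist c (twist c u) = u"
proof -
  define v where "v = frac u"
  define A where "A = (c - 1) * v"
  define B where "B = 1 - (1 - v) / (c - 1)"
  have v: "0 \<le> v" "v < 1" by (simp_all add: v_def frac_ge_0 frac_lt_1)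
  have AB: "A / (c - 1) = v" "(c - 1) * (1 - B) = 1 - v"
    using assms by (simp_all add: A_def B_def)
  have "max (min A B / (c - 1)) (1 - (c - 1) * (1 - min A B)) = v"
  proof (cases "A \<le> B")
    case True
    have "(c - 1) * (1 - B) \<le> (c - 1) * (1 - A)"
      using True assms by (intro mult_left_mono) auto
    then show ?thesis using True AB by simp
  next
    case False
    have "B / (c - 1) \<le> A / (c - 1)"
      using False assms by (intro divide_right_mono) auto
    then show ?thesis using False AB by simp
  qed
  then show ?thesis
    using twist_offset(1,2)[OF assms v] floor_add_unit[of "min A B" "\<lfloor>u\<rfloor>"]
    by (simp add: twist_def untwist_def A_def B_def v_def[symmetric]) (simp add: v_def frac_def)
qed

lemma twist_untwist:
  assumes "2 < c"
  shows "twist c (untwist c u) = u"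
proof -
  define v where "v = frac u"
  define A where "A = v / (c - 1)"
  define B where "B = 1 - (c - 1) * (1 - v)"
  have v: "0 \<le> v" "v < 1" by (simp_all add: v_def frac_ge_0 frac_lt_1)
  have AB: "(c - 1) * A = v" "(1 - B) / (c - 1) = 1 - v"
    using assms by (simp_all add: A_def B_def)
  have "min ((c - 1) * max A B) (1 - (1 - max A B) / (c - 1)) = v"
  proof (cases "A \<le> B")
    case True
    have "(c - 1) * A \<le> (c - 1) * B"
      using True assms by (intro mult_left_mono) auto
    then show ?thesis using True AB by simp
  next
    case False
    have "(1 - A) / (c - 1) \<le> (1 - B) / (c - 1)"
      using False assms by (intro divide_right_mono) auto
    then show ?thesis using False AB by simp
  qed
  then show ?thesis
    using twist_offset(3,4)[OF assms v] floor_add_unit[of "max A B" "\<lfloor>u\<rfloor>"]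
    by (simp add: twist_def untwist_def A_def B_def v_def[symmetric]) (simp add: v_def frac_def)
qed

lemma twist_add_int [simp]: "twist c (u + of_int n) = twist c u + of_int n"
  by (simp add: twist_def frac_def)

lemma untwist_add_int [simp]: "untwist c (u + of_int n) = untwist c u + of_int n"
  by (simp add: untwist_def frac_def)

lemma twist_strict_mono:
  assumes c: "2 < c" and u: "u < u'"
  shows "twist c u < twist c u'"
proof (cases "\<lfloor>u\<rfloor> = \<lfloor>u'\<rfloor>")
  case True
  then have "frac u < frac u'" using u by (simp add: frac_def)
  then have "(c - 1) * frac u < (c - 1) * frac u'" "(1 - frac u') / (c - 1) < (1 - frac u) / (c - 1)"
    using c by (auto intro: divide_strict_right_mono)
  then show ?thesis using True by (auto simp: twist_def min_def)
next
  case False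
  \<comment> \<open>With different integer parts, the two images are separated by an
    integer.\<close>
  then have "\<lfloor>u\<rfloor> + 1 \<le> \<lfloor>u'\<rfloor>" using u floor_mono[of u u'] by linarith
  then have "real_of_int \<lfloor>u\<rfloor> + 1 \<le> real_of_int \<lfloor>u'\<rfloor>" by linarith
  moreover have "twist c u < of_int \<lfloor>u\<rfloor> + 1" "of_int \<lfloor>u'\<rfloor> \<le> twist c u'"
    using twist_offset[OF c frac_ge_0 frac_lt_1] by (auto simp: twist_def)
  ultimately show ?thesis by linarith
qed

lemma untwist_strict_mono:
  assumes c: "2 < c" and u: "u < u'"
  shows "untwist c u < untwist c u'"
proof (rule ccontr)
  assume "\<not> untwist c u < untwist c u'"
  then have "untwist c u' < untwist c u \<or> untwist c u' = untwist c u" by linarith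
  then have "twist c (untwist c u') \<le> twist c (untwist c u)"
    using twist_strict_mono[OF c, of "untwist c u'" "untwist c u"] by auto
  then show False using u by (simp add: twist_untwist[OF c])
qed

lemma bij_twist: "2 < c \<Longrightarrow> bij (twist c)"
  by (rule o_bij[of "untwist c"]) (auto simp: untwist_twist twist_untwist)

lemma bij_untwist: "2 < c \<Longrightarrow> bij (untwist c)"
  by (rule o_bij[of "twist c"]) (auto simp: untwist_twist twist_untwist)

lemma twist_zero [simp]: "2 < c \<Longrightarrow> twist c 0 = 0"
  by (simp add: twist_def field_simps)

lemma twist_break:
  assumes "2 < c"
  shows "twist c (1 / c) = 1 - 1 / c"
proof -
  have "\<lfloor>1 / c\<rfloor> = 0" using assms by (simp add: floor_eq_iff field_simps)
  then show ?thesis using assms by (simp add: twist_def frac_def field_simps)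
qed

section \<open>The generators as increasing maps of the line\<close>

context artin_even
begin

text \<open>The formula for \<open>s\<close> is chosen so that \<open>st\<close> becomes the
  translation by \<open>1 - 1/k\<close>.\<close>

definition line :: "artin_gen \<Rightarrow> real \<Rightarrow> real" where
  "line g u = (if g = Gen_t then twist (2 * real k) u else untwist (2 * real k) u + 1 - 1 / k)"

lemma two_less: "2 < (2 * real k)"
  using k by simp

lemma line_strict_mono: "u < u' \<Longrightarrow> line g u < line g u'"
  using twist_strict_mono[OF two_less] untwist_strict_mono[OF two_less] by (simp add: line_def)

lemma line_mono: "u \<le> u' \<Longrightarrow> line g u \<le> line g u'"
  using line_strict_mono[of u u' g] by (cases "u = u'") auto

lemma line_add_int: "line g (u + of_int n) = line g u + of_int n"
  by (simp add: line_def)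

lemma line_s_t: "line Gen_s (line Gen_t u) = u + 1 - 1 / k"
  by (simp add: line_def untwist_twist[OF two_less])

lemma line_int: "line Gen_t (of_int n) = of_int n" "line Gen_s (of_int n) = of_int n + 1 - 1 / k"
proof -
  show t: "line Gen_t (of_int n) = of_int n" for n
    using line_add_int[of Gen_t 0 n] twist_zero[OF two_less] by (simp add: line_def)
  show "line Gen_s (of_int n) = of_int n + 1 - 1 / k"
    using line_s_t[of "of_int n"] by (simp add: t)
qed

text \<open>The ping-pong points: \<open>t\<close> throws whatever lies above the first to above the
  second, and the second is a barrier that repeated letters \<open>s\<close> cannot carry a point
  across.\<close>

lemma line_break:
  "line Gen_t (of_int n + 1 / (2 * real k)) = of_int n + 1 - 1 / (2 * real k)"
  "line Gen_s (of_int n + 1 - 1 / (2 * real k)) = of_int n + 1 - 1 / (2 * real k)"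
proof -
  show t: "line Gen_t (of_int n + 1 / (2 * real k)) = of_int n + 1 - 1 / (2 * real k)" for n
    using line_add_int[of Gen_t "1 / (2 * real k)" n] twist_break[OF two_less]
    by (simp add: line_def add.commute)
  have "line Gen_s (of_int n + 1 - 1 / (2 * real k)) = of_int n + 1 / (2 * real k) + 1 - 1 / k"
    using line_s_t[of "of_int n + 1 / (2 * real k)"] by (simp add: t)
  also have "\<dots> = of_int n + 1 - 1 / (2 * real k)"
    using k by (simp add: field_simps)
  finally show "line Gen_s (of_int n + 1 - 1 / (2 * real k)) = of_int n + 1 - 1 / (2 * real k)" .
qed

lemma bij_line: "bij (line g)"
proof (cases g)
  case Gen_s
  have "line Gen_s = (\<lambda>u. u + (1 - 1 / k)) \<circ> untwist (2 * real k)"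
    by (auto simp: line_def)
  moreover have "bij (\<lambda>u :: real. u + (1 - 1 / k))"
    by (rule o_bij[of "\<lambda>u. u - (1 - 1 / k)"]) auto
  ultimately show ?thesis using Gen_s bij_comp bij_untwist[OF two_less] by metis
next
  case Gen_t
  have "line Gen_t = twist (2 * real k)" by (auto simp: line_def)
  then show ?thesis using Gen_t bij_twist[OF two_less] by simp
qed

lemma foldr_line_st:
  "foldr line (alt_word Gen_s Gen_t (2 * i)) u = u + i * (1 - 1 / k)"
  by (induction i) (simp_all add: line_s_t algebra_simps add_divide_distrib)

lemma foldr_line_Delta:
  "foldr line (alt_word Gen_s Gen_t (2 * k)) u = u + (real k - 1)"
  "foldr line (alt_word Gen_t Gen_s (2 * k)) u = u + (real k - 1)"
proof -
  have kk: "k * (1 - 1 / k) = real k - 1" using k by (simp add: field_simps)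
  show "foldr line (alt_word Gen_s Gen_t (2 * k)) u = u + (real k - 1)"
    using foldr_line_st[of k u] kk by simp
  \<comment> \<open>As \<open>(ts)^k t = t (st)^k\<close>, it suffices to evaluate at points in the
    image of \<open>t\<close>; \<open>(st)^k\<close> is the translation by the integer
    \<open>k - 1\<close>, which commutes with \<open>t\<close>.\<close>
  obtain u' where u': "u = line Gen_t u'" using bij_line by (metis bij_pointE)
  have "foldr line (alt_word Gen_t Gen_s (2 * k)) (line Gen_t u') =
      foldr line (alt_word Gen_t Gen_s (2 * k) @ [Gen_t]) u'"
    by simp
  also have "alt_word Gen_t Gen_s (2 * k) @ [Gen_t] = alt_word Gen_t Gen_s (Suc (2 * k))"
    unfolding alt_word_snoc by simp
  also have "foldr line \<dots> u' = line Gen_t (u' + of_int (int k - 1))"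
    using foldr_line_st[of k u'] kk by simp
  finally show "foldr line (alt_word Gen_t Gen_s (2 * k)) u = u + (real k - 1)"
    unfolding line_add_int u' by simp
qed

definition act :: "artin_gen signed_word set \<Rightarrow> real \<Rightarrow> real" where
  "act = (SOME h. group_hom G perm_group h \<and> (\<forall>w. h (wd w) = foldr line w))"

lemma act: "group_hom G perm_group act" "act (wd w) = foldr line w"
proof -
  have "\<exists>h. group_hom G perm_group h \<and> (\<forall>w. h (wd w) = foldr line w)"
    using perm_action[of line, OF bij_line] foldr_line_Delta by metis
  from someI_ex[OF this] show "group_hom G perm_group act" "act (wd w) = foldr line w"
    by (simp_all add: act_def)
qed

lemma act_mult: "\<alpha> \<in> carrier G \<Longrightarrow> \<beta> \<in> carrier G \<Longrightarrow> act (\<alpha> \<otimes> \<beta>) u = act \<alpha> (act \<beta> u)"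
  using group_hom.hom_mult[OF act(1)] by simp

lemma act_one: "act \<one> u = u"
  using group_hom.hom_one[OF act(1)] by simp

lemma act_inv: "\<alpha> \<in> carrier G \<Longrightarrow> act \<alpha> (act (inv \<alpha>) u) = u" "\<alpha> \<in> carrier G \<Longrightarrow> act (inv \<alpha>) (act \<alpha> u) = u"
  using act_mult[of \<alpha> "inv \<alpha>" u] act_mult[of "inv \<alpha>" \<alpha> u] by (simp_all add: act_one)

lemma act_gen: "act (gen g) = line g"
  using act(2)[of "[g]"] by auto

lemma act_strict_mono:
  assumes "\<alpha> \<in> carrier G" "u < u'"
  shows "act \<alpha> u < act \<alpha> u'"
  using assms(1)
proof (induction \<alpha> rule: group_induct)
  case one
  then show ?case using assms(2) by (simp add: act_one)
next
  case (gen g \<beta>)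
  then show ?case by (simp add: act_mult act_gen line_strict_mono)
next
  case (inv g \<beta>)
  let ?v = "act (inv gen g) (act \<beta> u)" and ?v' = "act (inv gen g) (act \<beta> u')"
  have "line g ?v < line g ?v'"
    using inv act_inv(1)[of "gen g"] by (simp add: act_gen)
  then have "?v < ?v'"
    using line_mono[of ?v' ?v g] by linarith
  then show ?case using inv by (simp add: act_mult)
qed

lemma act_less_iff: "\<alpha> \<in> carrier G \<Longrightarrow> act \<alpha> u < act \<alpha> u' \<longleftrightarrow> u < u'"
  using act_strict_mono[of \<alpha> u u'] act_strict_mono[of \<alpha> u' u] by (metis linorder_less_linear order_less_asym)

lemma act_Dl_pow: "act (Dl [^] (n :: int)) u = u + n * (real k - 1)"
proof -
  have D: "act Dl u = u + (real k - 1)" for u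
    using foldr_line_Delta(1) by (simp add: Dl_def act(2))
  show ?thesis
  proof (induction n rule: int_induct[where k = 0])
    case (step1 i)
    have "Dl [^] (i + 1) = Dl \<otimes> Dl [^] i"
      using int_pow_mult[of Dl 1 i] by (simp add: add.commute)
    then show ?case using step1 by (simp add: D act_mult algebra_simps)
  next
    case (step2 i)
    have "Dl [^] i = Dl \<otimes> Dl [^] (i - 1)"
      using int_pow_mult[of Dl 1 "i - 1"] by simp
    then show ?case using step2 by (simp add: D act_mult algebra_simps)
  qed (simp add: act_one)
qed

lemma act_t_pow: "act (gen Gen_t [^] (n :: int)) 0 = 0"
proof -
  have t: "act (gen Gen_t) 0 = 0" using line_int(1)[of 0] by (simp add: act_gen)
  have nat: "act (gen Gen_t [^] (n :: nat)) 0 = 0" for n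
    by (induction n) (simp_all add: act_one act_mult t)
  show ?thesis
  proof (cases n rule: int_cases2)
    case (nonneg l)
    then show ?thesis by (simp add: int_pow_int nat)
  next
    case (nonpos l)
    then show ?thesis
      using act_inv(2)[of "gen Gen_t [^] l" 0] by (simp add: int_pow_neg_int nat)
  qed
qed

lemma act_nf: "act (wd w \<otimes> Dl [^] (n :: int)) 0 = foldr line w 0 + n * (real k - 1)"
proof -
  have "act (wd w \<otimes> Dl [^] n) 0 = act (Dl [^] n \<otimes> wd w) 0"
    by (simp add: Dl_pow_central)
  then show ?thesis by (simp add: act_mult act_Dl_pow act(2))
qed

subsection \<open>The orbit of the origin\<close>

text \<open>With \<open>q\<close> syllables, \<open>t\<close> fixes the bound \<open>q\<close>, and
  a new syllable moves it to \<open>q + 1 - 1/k\<close>. The third conjunct handles repeated letters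
  \<open>s\<close>, which fix \<open>q - 1/(2k)\<close> and so keep the point below it.\<close>

lemma orbit_upper:
  "foldr line w 0 \<le> s_syllables w \<and>
   (if s_syllables w = 0 then foldr line w 0 = 0 else foldr line w 0 < s_syllables w) \<and>
   (w \<noteq> [] \<and> hd w = Gen_s \<longrightarrow> foldr line w 0 < s_syllables w - 1 / (2 * real k) \<and> 0 < s_syllables w)"
proof (induction w)
  case (Cons g w)
  let ?a = "foldr line w 0" and ?q = "s_syllables w"
  show ?case
  proof (cases g)
    case Gen_t
    have t: "line Gen_t (real ?q) = real ?q" using line_int(1)[of "int ?q"] by simp
    have "line Gen_t ?a \<le> real ?q" using line_mono[of ?a "real ?q" Gen_t] Cons t by simp
    moreover have "?q = 0 \<Longrightarrow> line Gen_t ?a = 0" using Cons line_int(1)[of 0] by simp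
    moreover have "?q \<noteq> 0 \<Longrightarrow> line Gen_t ?a < real ?q"
      using line_strict_mono[of ?a "real ?q" Gen_t] Cons t by simp
    ultimately show ?thesis using Gen_t by simp
  next
    case Gen_s
    show ?thesis
    proof (cases "w = [] \<or> hd w = Gen_t")
      case True
      have "line Gen_s ?a \<le> real ?q + 1 - 1 / k"
        using line_mono[of ?a "real ?q" Gen_s] line_int(2)[of "int ?q"] Cons by simp
      also have "\<dots> < real ?q + 1 - 1 / (2 * real k)" using k by (simp add: field_simps)
      finally have "line Gen_s ?a < real ?q + 1 - 1 / (2 * real k)" .
      moreover from this have "line Gen_s ?a < real ?q + 1"
        by (rule less_trans) (use k in simp)
      ultimately show ?thesis using True Gen_s by (simp add: add.commute)
    next
      case False
      then have w: "w \<noteq> []" "hd w = Gen_s" using neq_iff_flip[of _ Gen_t] by auto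
      then have a: "?a < real ?q - 1 / (2 * real k)" "0 < ?q" using Cons by auto
      have "line Gen_s (real ?q - 1 / (2 * real k)) = real ?q - 1 / (2 * real k)"
        using line_break(2)[of "int ?q - 1"] by simp
      then have "line Gen_s ?a < real ?q - 1 / (2 * real k)"
        using line_strict_mono[OF a(1), of Gen_s] by simp
      moreover from this have "line Gen_s ?a < real ?q"
        by (rule less_trans) (use k in simp)
      ultimately show ?thesis using w a(2) Gen_s False by simp
    qed
  qed
qed simp

section \<open>The lower orbit bound and its equality case\<close>

definition rot :: "nat \<Rightarrow> artin_gen signed_word set \<Rightarrow> bool" where
  "rot n \<alpha> \<longleftrightarrow> (\<exists>(i :: int) (j :: int). \<alpha> = (gen Gen_s \<otimes> gen Gen_t) [^] n \<otimes> (gen Gen_t [^] i \<otimes> Dl [^] j))"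

lemma rot_Suc:
  assumes "rot n \<alpha>"
  shows "rot (Suc n) (gen Gen_s \<otimes> (gen Gen_t \<otimes> \<alpha>))"
proof -
  obtain i j :: int where "\<alpha> = (gen Gen_s \<otimes> gen Gen_t) [^] n \<otimes> (gen Gen_t [^] i \<otimes> Dl [^] j)"
    using assms by (auto simp: rot_def)
  then have "gen Gen_s \<otimes> (gen Gen_t \<otimes> \<alpha>) =
      (gen Gen_s \<otimes> gen Gen_t) \<otimes> (gen Gen_s \<otimes> gen Gen_t) [^] n \<otimes> (gen Gen_t [^] i \<otimes> Dl [^] j)"
    by (simp add: m_assoc)
  also have "(gen Gen_s \<otimes> gen Gen_t) \<otimes> (gen Gen_s \<otimes> gen Gen_t) [^] n = (gen Gen_s \<otimes> gen Gen_t) [^] Suc n"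
    by (rule nat_pow_Suc2[symmetric]) simp
  finally show ?thesis unfolding rot_def by blast
qed

lemma st_pow_k: "(gen Gen_s \<otimes> gen Gen_t) [^] k = Dl"
proof -
  have "(gen Gen_s \<otimes> gen Gen_t) [^] n = wd (alt_word Gen_s Gen_t (2 * n))" for n
  proof (induction n)
    case (Suc n)
    then show ?case
      unfolding nat_pow_Suc2[OF m_closed[OF gen_closed gen_closed]] by (simp add: m_assoc)
  qed simp
  then show ?thesis by (simp add: Dl_def)
qed

text \<open>\<open>(st)^k\<close> is \<Delta> and is absorbed into the power of \<Delta>.\<close>

lemma rot_k: "rot k \<alpha> \<longleftrightarrow> (\<exists>(i :: int) (j :: int). \<alpha> = gen Gen_t [^] i \<otimes> Dl [^] j)"
proof -
  have "Dl \<otimes> (gen Gen_t [^] i \<otimes> Dl [^] j) = gen Gen_t [^] i \<otimes> Dl [^] (j + 1)" for i j :: int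
  proof -
    have "Dl \<otimes> (gen Gen_t [^] i \<otimes> Dl [^] j) = gen Gen_t [^] i \<otimes> (Dl [^] j \<otimes> Dl)"
      by (simp add: Dl_central m_assoc)
    also have "Dl [^] j \<otimes> Dl = Dl [^] (j + 1)"
      using int_pow_mult[of Dl j 1] by simp
    finally show ?thesis .
  qed
  then show ?thesis unfolding rot_def st_pow_k by (metis diff_add_cancel)
qed

text \<open>Borrowing a letter from the power of \<open>t\<close> turns \<open>s\<close> into
  \<open>st\<close>; this restarts the count when a new run begins.\<close>

lemma rot_one:
  assumes "\<alpha> = gen Gen_t [^] (i :: int) \<otimes> Dl [^] (j :: int)"
  shows "rot 1 (gen Gen_s \<otimes> \<alpha>)"
proof -
  have "gen Gen_t [^] i = gen Gen_t \<otimes> gen Gen_t [^] (i - 1)"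
    using int_pow_mult[of "gen Gen_t" 1 "i - 1"] by simp
  then have "gen Gen_s \<otimes> \<alpha> = (gen Gen_s \<otimes> gen Gen_t) [^] (1 :: nat) \<otimes> (gen Gen_t [^] (i - 1) \<otimes> Dl [^] j)"
    using assms by (simp add: m_assoc)
  then show ?thesis unfolding rot_def by blast
qed

text \<open>The run length \<open>L\<close> of \<open>w\<close> controls how far the orbit point lies below \<open>s_syllables w\<close>; in
  the case of a leading \<open>t\<close> the bound is stated for the point before \<open>t\<close> is applied, since
  \<open>st\<close> acts as a translation. The bound \<open>s_syllables w - 1\<close> obtained for \<open>L = 2 * k - 1\<close> can
  be attained, but only on elements of the form \<open>t\<^sup>i \<Delta>\<^sup>j\<close>; this is what \<open>rot\<close> keeps track of.\<close>

lemma orbit_lower: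
  assumes "reduced (2 * k) (g # w)"
  defines "q \<equiv> real (s_syllables (g # w))" and "L \<equiv> run (g # w)"
  shows "(g = Gen_s \<longrightarrow> q - (L + 1) / (2 * real k) \<le> foldr line (g # w) 0 \<and>
      (odd L \<longrightarrow> q - (L + 1) / (2 * real k) < foldr line (g # w) 0 \<or> rot ((L + 1) div 2) (wd (g # w)))) \<and>
    (g = Gen_t \<longrightarrow> q - L / (2 * real k) \<le> foldr line w 0 \<and>
      (even L \<longrightarrow> q - L / (2 * real k) < foldr line w 0 \<or> rot (L div 2) (wd w)))"
  using assms(1) unfolding q_def L_def
proof (induction w arbitrary: g)
  case Nil
  have "rot 1 (gen Gen_s \<otimes> \<one>)" by (rule rot_one[of _ 0 0]) simp
  then show ?case using k line_int(2)[of 0] by (auto simp: run_Cons field_simps)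
next
  case (Cons h w)
  let ?a = "foldr line (h # w) 0" and ?q = "real (s_syllables (h # w))" and ?L = "run (h # w)"
  have red: "reduced (2 * k) (h # w)" and L: "?L + 1 \<le> 2 * k"
    using Cons.prems by simp_all
  \<comment> \<open>Runs in a reduced word have length at most \<open>2 * k - 1\<close>, so the
    bound is never worse than \<open>?q - 1\<close>.\<close>
  have L': "(real ?L + 1) / (2 * real k) \<le> 1" using L k by (simp add: field_simps)
  note IH = Cons.IH[OF red]
  have s_case: "real (s_syllables (g # h # w)) - (run (g # h # w) + 1) / (2 * real k) \<le> foldr line (g # h # w) 0 \<and>
    (odd (run (g # h # w)) \<longrightarrow>
      real (s_syllables (g # h # w)) - (run (g # h # w) + 1) / (2 * real k) < foldr line (g # h # w) 0 \<or>
      rot ((run (g # h # w) + 1) div 2) (wd (g # h # w)))" if g: "g = Gen_s"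
  proof (cases h)
    case Gen_t
    \<comment> \<open>The translation by \<open>1 - 1/k\<close> matches exactly one more syllable
      and one more letter in the run, so equality is carried along.\<close>
    have "foldr line (g # h # w) 0 = foldr line w 0 + 1 - 1 / k"
      using g Gen_t by (simp add: line_s_t)
    moreover have "run (g # h # w) = Suc ?L" "s_syllables (g # h # w) = Suc (s_syllables (h # w))"
      using g Gen_t by (simp_all add: run_Cons)
    moreover have "?q + 1 - (real ?L + 1 + 1) / (2 * real k) = (?q - ?L / (2 * real k)) + 1 - 1 / k"
      using k by (simp add: field_simps)
    moreover have "rot ((Suc ?L + 1) div 2) (wd (g # h # w))" if "odd (Suc ?L)" "rot (?L div 2) (wd w)"
      using rot_Suc[OF that(2)] that(1) g Gen_t by simp
    ultimately show ?thesis using IH[THEN conjunct2] Gen_t by (auto simp: add.commute)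
  next
    case Gen_s
    \<comment> \<open>The syllable continues but the run restarts: only the bound
      \<open>?q - 1\<close> is kept, and \<open>s\<close> maps it to the bound for a run of length
      1.\<close>
    have qi: "?q - 1 = of_int (int (s_syllables (h # w)) - 1)" by simp
    have e: "run (g # h # w) = 1" "s_syllables (g # h # w) = s_syllables (h # w)"
      using g Gen_s by (simp_all add: run_Cons)
    have s: "line Gen_s (?q - 1) = ?q - (1 + 1) / (2 * real k)"
      unfolding qi line_int using k by (simp add: field_simps)
    have "?q - 1 \<le> ?a" using IH[THEN conjunct1] Gen_s L' by auto
    then have le: "?q - (1 + 1) / (2 * real k) \<le> line Gen_s ?a"
      using line_mono s by metis
    \<comment> \<open>Equality with \<open>?q - 1\<close> needs an old run of maximal length
      \<open>2 * k - 1\<close>, and then \<open>rot k\<close> holds.\<close>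
    have "?q - 1 < ?a \<or> rot k (wd (h # w))"
    proof (cases "?L + 1 = 2 * k")
      case True
      then have "odd ?L" "(?L + 1) div 2 = k" "(real ?L + 1) / (2 * real k) = 1"
        using k by (presburger, simp, simp add: field_simps)
      then show ?thesis using IH[THEN conjunct1] Gen_s by auto
    next
      case False
      then have "(real ?L + 1) / (2 * real k) < 1" using L k by (simp add: field_simps)
      then show ?thesis using IH[THEN conjunct1] Gen_s by auto
    qed
    then have "?q - (1 + 1) / (2 * real k) < line Gen_s ?a \<or> rot 1 (gen Gen_s \<otimes> wd (h # w))"
      using line_strict_mono s rot_one unfolding rot_k by metis
    then show ?thesis using le e g by simp
  qed
  have t_case: "real (s_syllables (g # h # w)) - run (g # h # w) / (2 * real k) \<le> foldr line (h # w) 0 \<and>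
    (even (run (g # h # w)) \<longrightarrow>
      real (s_syllables (g # h # w)) - run (g # h # w) / (2 * real k) < foldr line (h # w) 0 \<or>
      rot (run (g # h # w) div 2) (wd (h # w)))" if g: "g = Gen_t"
  proof (cases h)
    case Gen_s
    have "run (g # h # w) = Suc ?L" "s_syllables (g # h # w) = s_syllables (h # w)"
      using g Gen_s by (simp_all add: run_Cons)
    then show ?thesis using IH[THEN conjunct1] Gen_s by (auto simp: add.commute)
  next
    case Gen_t
    have e: "run (g # h # w) = 1" "s_syllables (g # h # w) = s_syllables (h # w)"
      using g Gen_t by (simp_all add: run_Cons)
    \<comment> \<open>The point before the earlier \<open>t\<close> is at least
      \<open>?q - 1 + 1/(2k)\<close>, which \<open>t\<close> throws to \<open>?q - 1/(2k)\<close>.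
      The new run has odd length 1, so no equality case arises.\<close>
    have "?q - 1 + 1 / (2 * real k) \<le> ?q - ?L / (2 * real k)"
      using L' unfolding add_divide_distrib by linarith
    also have "\<dots> \<le> foldr line w 0" using IH[THEN conjunct2] Gen_t by auto
    finally have "line Gen_t (?q - 1 + 1 / (2 * real k)) \<le> ?a"
      using Gen_t line_mono by simp
    moreover have "line Gen_t (?q - 1 + 1 / (2 * real k)) = ?q - 1 / (2 * real k)"
      using line_break(1)[of "int (s_syllables (h # w)) - 1"] by simp
    ultimately show ?thesis using e by simp
  qed
  show ?case
    using s_case t_case by (simp add: add.commute)
qed

text \<open>By the bound on run lengths the loss in \<open>orbit_lower\<close> is at most 1. A
  leading \<open>t\<close> brings the point to at least \<open>q - 1/(2k)\<close>, where
  \<open>q\<close> is the number of syllables; with a leading \<open>s\<close>, a loss of exactly 1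
  forces \<open>rot k\<close>.\<close>

lemma orbit_bounds:
  assumes red: "reduced (2 * k) w" and q: "s_syllables w \<noteq> 0"
  shows "real (s_syllables w) - 1 < foldr line w 0 \<or>
    foldr line w 0 = real (s_syllables w) - 1 \<and> (\<exists>(i :: int) (j :: int). wd w = gen Gen_t [^] i \<otimes> Dl [^] j)"
proof -
  obtain g v where w: "w = g # v" using q by (cases w) auto
  let ?L = "run w"
  have L: "?L + 1 \<le> 2 * k" using red w by simp
  have L': "(real ?L + 1) / (2 * real k) \<le> 1" using L k by (simp add: field_simps)
  show ?thesis
  proof (cases g)
    case Gen_s
    note lower = orbit_lower[OF red[unfolded w], THEN conjunct1, folded w, rule_format, OF Gen_s]
    show ?thesis
    proof (cases "?L + 1 = 2 * k")
      case True
      then have "odd ?L" "(?L + 1) div 2 = k" "(real ?L + 1) / (2 * real k) = 1"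
        using k by (presburger, simp, simp add: field_simps)
      then show ?thesis using lower rot_k by auto
    next
      case False
      then have "(real ?L + 1) / (2 * real k) < 1" using L k by (simp add: field_simps)
      then show ?thesis using lower by auto
    qed
  next
    case Gen_t
    note lower = orbit_lower[OF red[unfolded w], THEN conjunct2, folded w, rule_format, OF Gen_t]
    have "real (s_syllables w) - 1 + 1 / (2 * real k) \<le> foldr line v 0"
      using lower L' k by (simp add: field_simps)
    then have "line Gen_t (real (s_syllables w) - 1 + 1 / (2 * real k)) \<le> foldr line w 0"
      using Gen_t line_mono w by simp
    moreover have "line Gen_t (real (s_syllables w) - 1 + 1 / (2 * real k)) = real (s_syllables w) - 1 / (2 * real k)"
      using line_break(1)[of "int (s_syllables w) - 1"] by simp
    moreover have "1 / (2 * real k) < 1" using k by simp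
    ultimately show ?thesis by simp
  qed
qed

section \<open>Stabilizer of the origin and signs of elements\<close>

lemma s_syllables_zero: "s_syllables w = 0 \<Longrightarrow> w = replicate (length w) Gen_t"
proof (induction w)
  case (Cons g w)
  then show ?case
    using neq_iff_flip[of _ Gen_t] neq_iff_flip[of g Gen_s] by (cases w) (auto split: if_splits)
qed simp

text \<open>With \<open>q > 0\<close> syllables the point lies in \<open>[q - 1, q)\<close>; an
  integer there must be \<open>q - 1\<close>, the equality case.\<close>

lemma orbit_integer:
  assumes red: "reduced (2 * k) w" and n: "foldr line w 0 = of_int n"
  shows "\<exists>(i :: int) (j :: int). wd w = gen Gen_t [^] i \<otimes> Dl [^] j"
proof (cases "s_syllables w = 0")
  case True
  then have "wd w = gen Gen_t [^] int (length w) \<otimes> Dl [^] (0 :: int)"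
    using s_syllables_zero[OF True] wd_replicate[of "length w" Gen_t] by (simp add: int_pow_int)
  then show ?thesis by blast
next
  case False
  have "foldr line w 0 < s_syllables w" using orbit_upper[of w] False by simp
  then have "n < int (s_syllables w)" unfolding n by linarith
  then have "\<not> real (s_syllables w) - 1 < foldr line w 0" unfolding n by linarith
  then show ?thesis using orbit_bounds[OF red False] by auto
qed

text \<open>The word part sends 0 to an integer, so \<alpha> is a power of \<open>t\<close> times a
  power of \<Delta>; \<open>t\<close> fixes 0 while \<Delta> translates by \<open>k - 1 > 0\<close>,
  so the latter power is trivial.\<close>

lemma act_zero_iff:
  assumes "\<alpha> \<in> carrier G"
  shows "act \<alpha> 0 = 0 \<longleftrightarrow> \<alpha> \<in> generate G {gen Gen_t}"
proof
  assume 0: "act \<alpha> 0 = 0"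
  obtain w n where w: "reduced (2 * k) w" "\<alpha> = wd w \<otimes> Dl [^] (n :: int)"
    using nf_exists[OF assms] .
  have "foldr line w 0 = of_int (- n * (int k - 1))"
    using 0 by (simp add: w(2) act_nf algebra_simps)
  then obtain i j :: int where "wd w = gen Gen_t [^] i \<otimes> Dl [^] j"
    using orbit_integer[OF w(1)] by blast
  then have \<alpha>: "\<alpha> = gen Gen_t [^] i \<otimes> Dl [^] (j + n)"
    by (simp add: w(2) m_assoc int_pow_mult)
  then have "\<alpha> = Dl [^] (j + n) \<otimes> gen Gen_t [^] i"
    by (simp add: Dl_pow_central)
  then have "(j + n) * (real k - 1) = 0"
    using 0 by (simp add: act_mult act_t_pow act_Dl_pow)
  then have "j + n = 0" using k by (simp flip: of_int_add)
  then have "\<alpha> = gen Gen_t [^] i" using \<alpha> by simp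
  then show "\<alpha> \<in> generate G {gen Gen_t}" by (auto simp: generate_pow)
next
  assume "\<alpha> \<in> generate G {gen Gen_t}"
  then show "act \<alpha> 0 = 0" by (auto simp: generate_pow act_t_pow)
qed

text \<open>For \<open>\<alpha> = w \<Delta>^(-j)\<close> with \<open>q\<close> syllables in
  \<open>w\<close>, the depth condition reads \<open>q \<le> j(k - 1)\<close>, while 0 moves left
  iff \<open>w(0) < j(k - 1)\<close>. For \<open>q > 0\<close> these agree, as \<open>w(0)\<close>
  lies in \<open>[q - 1, q)\<close> and \<open>j(k - 1)\<close> is an integer.\<close>

lemma dehornoy_negative_iff:
  "dehornoy_negative G M Dl (powers Gen_s) (powers Gen_t) \<alpha> \<longleftrightarrow> \<alpha> \<in> carrier G \<and> act \<alpha> 0 < 0"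
proof
  assume "dehornoy_negative G M Dl (powers Gen_s) (powers Gen_t) \<alpha>"
  then obtain a and j :: int where \<alpha>: "\<alpha> \<in> carrier G" "unmovable G M Dl a" "\<alpha> = a \<otimes> Dl [^] (- j)" "1 \<le> j"
    and d: "dpt G M (powers Gen_t) (powers Gen_s) a < dpt G M (powers Gen_t) (powers Gen_s) (Dl [^] j)"
    unfolding dehornoy_negative_def is_Delta_form_def by blast
  obtain w where w: "reduced (2 * k) w" "a = wd w" using \<alpha>(2) unmovable_iff by blast
  have "s_syllables w < dpt G M (powers Gen_t) (powers Gen_s) (Dl [^] j)"
    using d dpt_wd[OF w(1)] w(2) by simp
  then have "int (s_syllables w) \<le> j * (int k - 1)"
    using dpt_Dl_pow[OF \<alpha>(4)] by linarith
  then have "real_of_int (int (s_syllables w)) \<le> real_of_int (j * (int k - 1))"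
    unfolding of_int_le_iff .
  then have le: "real (s_syllables w) \<le> j * (real k - 1)"
    by simp
  \<comment> \<open>Needed for \<open>q = 0\<close>, where the image of 0 under \<open>w\<close>
    equals \<open>q\<close> instead of lying strictly below it.\<close>
  have "0 < j * (real k - 1)" using \<alpha>(4) k by simp
  then have "foldr line w 0 < j * (real k - 1)"
    using orbit_upper[of w] le by (auto split: if_splits)
  then show "\<alpha> \<in> carrier G \<and> act \<alpha> 0 < 0"
    using \<alpha>(1,3) act_nf[of w "- j"] w(2) by simp
next
  assume \<alpha>: "\<alpha> \<in> carrier G \<and> act \<alpha> 0 < 0"
  then obtain w n where w: "reduced (2 * k) w" "\<alpha> = wd w \<otimes> Dl [^] (n :: int)"
    using nf_exists by metis
  define j where "j = - n"
  have lt: "foldr line w 0 < j * (real k - 1)"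
    using \<alpha> by (simp add: w(2) act_nf j_def)
  have lower: "0 \<le> foldr line w 0" "real (s_syllables w) - 1 \<le> foldr line w 0"
    using orbit_bounds[OF w(1)] orbit_upper[of w] by (auto split: if_splits)
  \<comment> \<open>\<open>w\<close> never moves 0 to the left, so only a negative power of \<Delta>
    can.\<close>
  have "0 < j * (real k - 1)" using lt lower(1) by linarith
  then have j: "1 \<le> j" using k by (simp add: zero_less_mult_iff)
  have "real_of_int (int (s_syllables w)) < real_of_int (j * (int k - 1) + 1)"
    using lt lower(2) by simp
  then have "int (s_syllables w) < j * (int k - 1) + 1"
    unfolding of_int_less_iff .
  then have "dpt G M (powers Gen_t) (powers Gen_s) (wd w) < dpt G M (powers Gen_t) (powers Gen_s) (Dl [^] j)"
    using dpt_wd[OF w(1)] dpt_Dl_pow[OF j] by linarith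
  moreover have "is_Delta_form G M Dl \<alpha> (wd w) (- j)"
    using w unmovable_iff by (auto simp: is_Delta_form_def j_def)
  ultimately show "dehornoy_negative G M Dl (powers Gen_s) (powers Gen_t) \<alpha>"
    using \<alpha> j by (auto simp: dehornoy_negative_def)
qed

lemma act_inv_pos_iff:
  assumes "\<alpha> \<in> carrier G"
  shows "act (inv \<alpha>) 0 < 0 \<longleftrightarrow> 0 < act \<alpha> 0"
  using act_less_iff[OF assms, of "act (inv \<alpha>) 0" 0] act_inv(1)[OF assms, of 0] by simp

lemma dehornoy_positive_iff:
  "dehornoy_positive G M Dl (powers Gen_s) (powers Gen_t) \<alpha> \<longleftrightarrow> \<alpha> \<in> carrier G \<and> 0 < act \<alpha> 0"
  by (auto simp: dehornoy_positive_def dehornoy_negative_iff act_inv_pos_iff)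

lemma dehornoy_structure_artin:
  "dehornoy_structure (G, M, Dl) (H, powers Gen_s, L) (generate G {gen Gen_t}, powers Gen_t, D1)"
proof -
  let ?P = "{\<alpha>. dehornoy_positive G M Dl (powers Gen_s) (powers Gen_t) \<alpha>}"
  let ?T = "generate G {gen Gen_t}"
  have P: "?P = {\<alpha> \<in> carrier G. 0 < act \<alpha> 0}"
    by (auto simp: dehornoy_positive_iff)
  have T: "?T = {\<alpha> \<in> carrier G. act \<alpha> 0 = 0}"
    using act_zero_iff generate_incl[of "{gen Gen_t}"] by auto
  have neg: "act (inv \<alpha>) 0 < 0 \<longleftrightarrow> 0 < act \<alpha> 0" "0 < act (inv \<alpha>) 0 \<longleftrightarrow> act \<alpha> 0 < 0"
    if "\<alpha> \<in> carrier G" for \<alpha>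
    using act_inv_pos_iff[OF that] act_inv_pos_iff[of "inv \<alpha>"] that by auto
  have N: "set_inv ?P = {\<alpha> \<in> carrier G. act \<alpha> 0 < 0}"
  proof
    show "set_inv ?P \<subseteq> {\<alpha> \<in> carrier G. act \<alpha> 0 < 0}"
      unfolding P by (auto simp: SET_INV_def neg)
    show "{\<alpha> \<in> carrier G. act \<alpha> 0 < 0} \<subseteq> set_inv ?P"
    proof
      fix \<alpha> assume "\<alpha> \<in> {\<alpha> \<in> carrier G. act \<alpha> 0 < 0}"
      then have "inv \<alpha> \<in> ?P" "\<alpha> = inv (inv \<alpha>)"
        unfolding P by (auto simp: neg)
      then show "\<alpha> \<in> set_inv ?P" unfolding SET_INV_def by blast
    qed
  qed
  have mono: "act \<alpha> 0 < act \<alpha> (act \<beta> 0)" if "\<alpha> \<in> carrier G" "0 < act \<beta> 0" for \<alpha> \<beta>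
    using that by (simp add: act_strict_mono)
  have "?P <#> ?P \<subseteq> ?P"
  proof
    fix \<gamma> assume "\<gamma> \<in> ?P <#> ?P"
    then obtain \<alpha> \<beta> where "\<gamma> = \<alpha> \<otimes> \<beta>" "\<alpha> \<in> carrier G" "\<beta> \<in> carrier G" "0 < act \<alpha> 0" "0 < act \<beta> 0"
      unfolding P set_mult_def by blast
    then show "\<gamma> \<in> ?P" unfolding P using mono[of \<alpha> \<beta>] by (auto simp: act_mult)
  qed
  moreover have "?T <#> ?P <#> ?T \<subseteq> ?P"
  proof
    fix \<gamma> assume "\<gamma> \<in> ?T <#> ?P <#> ?T"
    then obtain \<sigma> \<alpha> \<tau> where "\<gamma> = \<sigma> \<otimes> \<alpha> \<otimes> \<tau>" "\<sigma> \<in> carrier G" "\<alpha> \<in> carrier G" "\<tau> \<in> carrier G"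
      "act \<sigma> 0 = 0" "0 < act \<alpha> 0" "act \<tau> 0 = 0"
      unfolding P T set_mult_def by blast
    \<comment> \<open>As \<tau> fixes 0, \<gamma> sends 0 to \<open>\<sigma>(\<alpha>(0))\<close>,
      which exceeds \<open>\<sigma>(0) = 0\<close>.\<close>
    then show "\<gamma> \<in> ?P" unfolding P using mono[of \<sigma> \<alpha>] by (simp add: act_mult)
  qed
  moreover have "carrier G = ?P \<union> set_inv ?P \<union> ?T"
    "?P \<inter> set_inv ?P = {}" "?P \<inter> ?T = {}" "set_inv ?P \<inter> ?T = {}"
    unfolding N unfolding P T by auto
  ultimately show ?thesis by (simp add: Let_def)
qed

end

theorem corollary5p2:
  fixes m k :: nat
    and G :: "artin_gen signed_word set monoid"
    and s t \<Delta> :: "artin_gen signed_word set"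
    and M G1 M1 H N :: "artin_gen signed_word set set"
  assumes "m = 2 * k" and "4 \<le> m"
    and "G = artin_I2 m"
    and "s = artin_I2_gen m Gen_s" and "t = artin_I2_gen m Gen_t"
    and "M = submonoid_generated G {s, t}" and "\<Delta> = alt_prod G s t m"
    and "G1 = generate G {t}" and "M1 = submonoid_generated G {t}"
    and "H = generate G {s}" and "N = submonoid_generated G {s}"
  shows "dehornoy_structure (G, M, \<Delta>) (H, N, s) (G1, M1, t)"
proof -
  interpret artin_even G k
    by (rule artin_even.intro, unfold artin_even_axioms_def)
      (use assms group_presented_group in \<open>auto simp: artin_I2_def\<close>)
  have gen: "gen Gen_s = s" "gen Gen_t = t"
    using assms by (simp_all add: gen_def)
  have wd: "wd w = foldr (\<otimes>\<^bsub>G\<^esub>) (map gen w) \<one>\<^bsub>G\<^esub>" for w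
    by (induction w) simp_all
  have Dl: "Dl = \<Delta>"
    using assms(1,7) gen by (simp add: Dl_def wd map_alt_word alt_prod_def)
  have sub: "artin_even.M G k = M" "powers Gen_s = N" "powers Gen_t = M1"
    by (simp_all only: M_def powers_def gen assms(6,9,11))
  show ?thesis
    using dehornoy_structure_artin[of H s t] unfolding Dl sub gen assms(8) .
qed

end
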